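(* Let $d\in\mathbb{N}$ and $1\le q\le 2$. There is a number $C(d,q)$, depending only on $d$ and $q$, such that for any $n\in\mathbb{N}$ there exist a positive integer $m\le C(d,q)\,|Q_n|\,n^{3}$ and points $\xi^1,\dots,\xi^m\in\mathbb{T}^d$ such that for any $f\in\mathcal{T}(Q_n)$ $$ \frac12\|f\|_q^q\le \frac1m\sum_{j=1}^m |f(\xi^j)|^q\le \frac32\|f\|_q^q . $$
   Context: $\mathbb{T}^d$ is the $d$-dimensional torus ($2\pi$-periodic in each variable) with the normalized Lebesgue (probability) measure $\mu$, and $\|f\|_q:=\left(\int_{\mathbb{T}^d}|f|^q\,d\mu\right)^{1/q}$. For $\mathbf{s}=(s_1,\dots,s_d)\in\mathbb{Z}_+^d$ (nonnegative integer vectors) define $$\rho(\mathbf{s}):=\{\mathbf{k}\in\mathbb{Z}^d:\ [2^{s_j-1}]\le |k_j|<2^{s_j},\ j=1,\dots,d\},$$ where $[x]$ is the integer part of $x$. The step hyperbolic cross is $$Q_n:=\bigcup_{\mathbf{s}\in\mathbb{Z}_+^d:\ \|\mathbf{s}\|_1\le n}\rho(\mathbf{s}),\qquad \|\mathbf{s}\|_1=s_1+\dots+s_d,$$ $|Q_n|$ is the number of elements of $Q_n$, and $$\mathcal{T}(Q_n):=\Big\{f:\ f(\mathbf{x})=\sum_{\mathbf{k}\in Q_n}c_{\mathbf{k}}e^{i(\mathbf{k},\mathbf{x})},\ c_{\mathbf{k}}\in\mathbb{C}\Big\}.$$ *)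

theory Defs
  imports "HOL-Analysis.Analysis" "HOL-Probability.Probability_Measure"
begin

text \<open>The torus of dimension \<open>CARD('d)\<close> is represented by the half-open fundamental cube; each point
  of the torus has exactly one representative in it.\<close>

definition torus :: "(real ^ 'd) set" where
  "torus = {x. \<forall>j. 0 \<le> x $ j \<and> x $ j < 2 * pi}"

definition torus_measure :: "(real ^ 'd) measure" where
  "torus_measure = uniform_measure lborel torus"

definition torus_norm :: "real \<Rightarrow> (real ^ 'd \<Rightarrow> complex) \<Rightarrow> real" where
  "torus_norm q f = (\<integral>x. cmod (f x) powr q \<partial>torus_measure) powr (1 / q)"

text \<open>For \<open>s $ j = 0\<close> the lower bound below is \<open>\<lfloor>1 / 2\<rfloor> = 0\<close>, so the exponent has to be taken in the
  integers.\<close>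

definition dyadic_block :: "nat ^ 'd \<Rightarrow> (int ^ 'd) set" where
  "dyadic_block s =
    {k. \<forall>j. \<lfloor>(2::real) powi (int (s $ j) - 1)\<rfloor> \<le> \<bar>k $ j\<bar> \<and> \<bar>k $ j\<bar> < 2 ^ (s $ j)}"

definition step_hyperbolic_cross :: "nat \<Rightarrow> (int ^ 'd) set" where
  "step_hyperbolic_cross n = (\<Union>s \<in> {s. (\<Sum>j\<in>UNIV. s $ j) \<le> n}. dyadic_block s)"

definition trig_polys :: "(int ^ 'd) set \<Rightarrow> (real ^ 'd \<Rightarrow> complex) set" where
  "trig_polys Q =
    {f. \<exists>c :: int ^ 'd \<Rightarrow> complex. \<forall>x.
      f x = (\<Sum>k\<in>Q. c k * exp (\<i> * complex_of_real (\<Sum>j\<in>UNIV. of_int (k $ j) * x $ j)))}"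

lemma finite_step_hyperbolic_cross: "finite (step_hyperbolic_cross n :: (int ^ 'd) set)"
proof -
  have "- (2 ^ n) \<le> k $ j \<and> k $ j \<le> 2 ^ n"
    if k: "k \<in> step_hyperbolic_cross n" for k :: "int ^ 'd" and j
  proof -
    obtain s :: "nat ^ 'd" where s: "(\<Sum>j\<in>UNIV. s $ j) \<le> n" "\<bar>k $ j\<bar> < 2 ^ (s $ j)"
      using k by (auto simp: step_hyperbolic_cross_def dyadic_block_def)
    have "s $ j \<le> (\<Sum>j\<in>UNIV. s $ j)"
      by (rule member_le_sum) auto
    then have "(2::int) ^ (s $ j) \<le> 2 ^ n"
      using s(1) by (intro power_increasing) auto
    then show ?thesis using s(2) by linarith
  qed
  then have "vec_nth ` step_hyperbolic_cross n \<subseteq> (PiE UNIV (\<lambda>_::'d. {- (2 ^ n) .. 2 ^ n :: int}))"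
    by auto
  then have "finite (vec_nth ` (step_hyperbolic_cross n :: (int ^ 'd) set))"
    by (rule finite_subset) (auto intro: finite_PiE)
  then show ?thesis
    by (rule finite_imageD) (auto simp: inj_on_def vec_eq_iff)
qed

lemma prob_space_torus_measure: "prob_space (torus_measure :: (real ^ 'd) measure)"
proof -
  let ?b = "(\<chi> j. 2 * pi) :: real ^ 'd"
  have sub: "box 0 ?b \<subseteq> torus" "torus \<subseteq> cbox 0 ?b"
    by (auto simp: torus_def mem_box_cart less_imp_le)
  have [measurable]: "(torus :: (real ^ 'd) set) \<in> sets borel"
    unfolding torus_def by measurable
  have "0 < emeasure lborel (box 0 ?b)"
    by (auto simp: emeasure_lborel_box_eq Basis_vec_def inner_axis intro!: prod_pos)
  also have "\<dots> \<le> emeasure lborel (torus :: (real ^ 'd) set)"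
    by (rule emeasure_mono[OF sub(1)]) simp
  finally have "emeasure lborel (torus :: (real ^ 'd) set) \<noteq> 0" by simp
  moreover have "emeasure lborel (torus :: (real ^ 'd) set) \<noteq> \<infinity>"
    using emeasure_mono[OF sub(2), of lborel] emeasure_lborel_cbox_finite[of 0 ?b]
    by (simp add: top_unique less_top[symmetric])
       (metis infinity_ennreal_def leD top.not_eq_extremum)
  ultimately show ?thesis
    unfolding torus_measure_def by (rule prob_space_uniform_measure)
qed

end

theory Submission imports Defs begin

text \<open>Let \<open>N = |Q_n|\<close>. Since \<open>\<bar>f\<bar> \<le> N powr (1 / q)\<close> on the unit ball of \<open>L\<^sub>q\<close>, only about \<open>n\<close> dyadic sizes of \<open>\<bar>f\<bar>\<close>
  matter. The layer of \<open>\<bar>f\<bar> powr q\<close> at size \<open>b\<close> is bounded by a multiple of \<open>b powr q\<close>, has integral at most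
  \<open>1\<close>, and changes little when \<open>f\<close> is replaced by an element of a uniform net at scale proportional to \<open>b\<close>. Such a net has
  log-cardinality of order \<open>N * n / b powr q\<close>, so by Bernstein's exponential moment bound all these layers are sampled with accuracy
  of order \<open>1 / n\<close> by some \<open>m\<close> points with \<open>m\<close> of order \<open>N * n ^ 3\<close>. The accuracy \<open>1 / n\<close> pays for summing over the layers.

  The entropy bound follows for \<open>q = 2\<close> from a greedy argument: a trigonometric polynomial of \<open>L\<^sub>2\<close>-norm \<open>r\<close> is
  approximated to within \<open>t\<close> on a finite norming set of \<open>2 ^ O(n)\<close> points by a combination of \<open>O(N * r\<^sup>2 / t\<^sup>2)\<close> kernels.
  For \<open>q < 2\<close> one passes from uniform scale \<open>2 * t\<close> to \<open>t\<close>, because the inequality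
  \<open>\<parallel>h\<parallel>\<^sub>2\<^sup>2 \<le> \<parallel>h\<parallel>\<^sub>\<infinity> powr (2 - q) * \<parallel>h\<parallel>\<^sub>q powr q\<close> turns closeness at scale \<open>2 * t\<close> into an \<open>L\<^sub>2\<close> bound; the
  resulting increments form a geometric series.\<close>

section \<open>Sampling finitely many functions\<close>

text \<open>If \<open>F\<close> exceeded its mean almost everywhere, its mean would exceed itself.
  Asking for a point of the full-measure set \<open>\<Omega>\<close> is what later puts the sampling
  points in the torus.\<close>

lemma (in prob_space) exists_le_expectation:
  fixes F :: "'a \<Rightarrow> real"
  assumes F: "integrable M F" and \<Omega>: "AE x in M. x \<in> \<Omega>"
  shows "\<exists>x\<in>\<Omega>. F x \<le> expectation F"
proof (rule ccontr)
  assume "\<not> ?thesis"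
  then have "AE x in M. expectation F < F x"
    using \<Omega> by (auto simp: not_le elim: AE_mp)
  then have "expectation (\<lambda>_. expectation F) < expectation F"
    by (intro integral_less_AE_space F) (auto simp: emeasure_space_1)
  then show False by (simp add: prob_space)
qed

text \<open>The points are chosen one at a time, each keeping the exponential potential below its average, so no
  product measure is needed.\<close>

lemma (in prob_space) exists_points_exp_sum_le:
  fixes X :: "'i \<Rightarrow> 'a \<Rightarrow> real" and \<rho> a :: "'i \<Rightarrow> real"
  assumes "finite I" and \<Omega>: "AE x in M. x \<in> \<Omega>"
    and int: "\<And>i. i \<in> I \<Longrightarrow> integrable M (\<lambda>x. exp (X i x))"
    and \<rho>: "\<And>i. i \<in> I \<Longrightarrow> expectation (\<lambda>x. exp (X i x)) \<le> \<rho> i"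
    and "\<And>i. i \<in> I \<Longrightarrow> 0 \<le> a i"
  shows "\<exists>\<xi>::nat \<Rightarrow> 'a. (\<forall>j\<in>{1..m}. \<xi> j \<in> \<Omega>) \<and>
    (\<Sum>i\<in>I. a i * exp (\<Sum>j=1..m. X i (\<xi> j))) \<le> (\<Sum>i\<in>I. a i * \<rho> i ^ m)"
  using assms(5)
proof (induction m arbitrary: a)
  case 0
  show ?case by simp
next
  case (Suc m)
  have \<rho>0: "0 \<le> \<rho> i" if "i \<in> I" for i
    using \<rho>[OF that] by (rule order_trans[rotated]) (intro integral_nonneg_AE, simp)
  let ?F = "\<lambda>x. \<Sum>i\<in>I. a i * \<rho> i ^ m * exp (X i x)"
  have "integrable M ?F" using int by simp
  then obtain x where x: "x \<in> \<Omega>" "?F x \<le> expectation ?F"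
    using exists_le_expectation[OF _ \<Omega>] by blast
  have "expectation ?F = (\<Sum>i\<in>I. a i * \<rho> i ^ m * expectation (\<lambda>x. exp (X i x)))"
    using int by simp
  also have "\<dots> \<le> (\<Sum>i\<in>I. a i * \<rho> i ^ m * \<rho> i)"
    using \<rho> \<rho>0 Suc.prems by (intro sum_mono mult_left_mono) auto
  finally have F: "?F x \<le> (\<Sum>i\<in>I. a i * \<rho> i ^ Suc m)"
    using x by (simp add: mult_ac)
  \<comment> \<open>The weights are arbitrary so that the factor contributed by the new point
    \<open>x\<close> can be absorbed into them.\<close>
  obtain \<xi> where \<xi>: "\<forall>j\<in>{1..m}. \<xi> j \<in> \<Omega>"
    "(\<Sum>i\<in>I. (a i * exp (X i x)) * exp (\<Sum>j=1..m. X i (\<xi> j))) \<le> (\<Sum>i\<in>I. (a i * exp (X i x)) * \<rho> i ^ m)"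
    using Suc.IH[of "\<lambda>i. a i * exp (X i x)"] Suc.prems by auto
  let ?\<xi> = "\<xi>(Suc m := x)"
  have "(\<Sum>j=1..Suc m. X i (?\<xi> j)) = X i x + (\<Sum>j=1..m. X i (\<xi> j))" for i
    by (simp add: add.commute)
  then have "(\<Sum>i\<in>I. a i * exp (\<Sum>j=1..Suc m. X i (?\<xi> j)))
      = (\<Sum>i\<in>I. (a i * exp (X i x)) * exp (\<Sum>j=1..m. X i (\<xi> j)))"
    by (simp add: exp_add mult.assoc del: sum.cl_ivl_Suc)
  also have "\<dots> \<le> ?F x" using \<xi>(2) by (simp add: mult_ac)
  also note F
  finally have "(\<Sum>i\<in>I. a i * exp (\<Sum>j=1..Suc m. X i (?\<xi> j))) \<le> (\<Sum>i\<in>I. a i * \<rho> i ^ Suc m)" .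
  moreover have "\<forall>j\<in>{1..Suc m}. ?\<xi> j \<in> \<Omega>" using \<xi>(1) x(1) by auto
  ultimately show ?case by blast
qed

lemma exp_le_quadratic:
  fixes y :: real
  assumes "\<bar>y\<bar> \<le> 1"
  shows "exp y \<le> 1 + y + y\<^sup>2"
proof (cases "0 \<le> y")
  case True
  then show ?thesis using exp_bound[of y] assms by simp
next
  case False
  define z where "z = - y"
  have z: "0 < z" "z \<le> 1" using False assms by (auto simp: z_def)
  have p: "0 < 1 - z + z\<^sup>2" using z by (smt (verit) zero_less_power)
  \<comment> \<open>The product equals \<open>1 + z ^ 3\<close>; combined with
    \<open>1 + z \<le> exp z\<close> it bounds \<open>exp (- z)\<close> from above.\<close>
  have "1 \<le> (1 - z + z\<^sup>2) * (1 + z)"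
    using z by (simp add: power2_eq_square algebra_simps)
  also have "\<dots> \<le> (1 - z + z\<^sup>2) * exp z"
    using p by (intro mult_left_mono) (auto simp: exp_ge_add_one_self)
  finally have "exp (- z) \<le> 1 - z + z\<^sup>2"
    by (simp add: exp_minus divide_simps mult.commute)
  then show ?thesis by (simp add: z_def)
qed

text \<open>Bernstein's moment bound: centering removes the linear term of the quadratic estimate
  for \<open>exp\<close>, and the variance is at most \<open>B\<close> rather than
  \<open>B\<^sup>2\<close>, because \<open>(h x)\<^sup>2 \<le> B * h x\<close> and the mean of
  \<open>h\<close> is at most \<open>1\<close>.\<close>

lemma (in prob_space) expectation_exp_centered_le:
  fixes h :: "'a \<Rightarrow> real"
  assumes [measurable]: "h \<in> borel_measurable M"
    and h: "\<And>x. 0 \<le> h x" "\<And>x. h x \<le> B" and E: "expectation h \<le> 1" and l: "\<bar>r\<bar> * B \<le> 1"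
  shows "integrable M (\<lambda>x. exp (r * (h x - expectation h)))"
    and "expectation (\<lambda>x. exp (r * (h x - expectation h))) \<le> exp (r\<^sup>2 * B)"
proof -
  let ?E = "expectation h"
  have ih: "integrable M h"
    by (rule integrable_const_bound[where B=B]) (use h in auto)
  have ih2: "integrable M (\<lambda>x. (h x)\<^sup>2)"
    by (rule integrable_const_bound[where B="B\<^sup>2"]) (use h in \<open>auto intro: power_mono\<close>)
  have E0: "0 \<le> ?E" using h by simp
  have EB: "?E \<le> B"
    using integral_mono[OF ih, of "\<lambda>_. B"] h by (simp add: prob_space)
  have y: "\<bar>r * (h x - ?E)\<bar> \<le> 1" for x
  proof -
    have "\<bar>h x - ?E\<bar> \<le> B" using h[of x] E0 EB by (auto simp: abs_le_iff intro: order_trans[of _ "h x"] ) 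
    then have "\<bar>r\<bar> * \<bar>h x - ?E\<bar> \<le> \<bar>r\<bar> * B" by (intro mult_left_mono) auto
    then show ?thesis using l by (simp add: abs_mult)
  qed
  show ie: "integrable M (\<lambda>x. exp (r * (h x - ?E)))"
    by (rule integrable_const_bound[where B="exp 1"])
       (use y in \<open>auto simp: abs_le_iff\<close>)
  have "expectation (\<lambda>x. exp (r * (h x - ?E))) \<le>
    expectation (\<lambda>x. 1 + (r * (h x - ?E) + r\<^sup>2 * ((h x)\<^sup>2 - 2 * ?E * h x + ?E\<^sup>2)))"
  proof (intro integral_mono ie)
    fix x
    show "exp (r * (h x - ?E)) \<le> 1 + (r * (h x - ?E) + r\<^sup>2 * ((h x)\<^sup>2 - 2 * ?E * h x + ?E\<^sup>2))"
      using exp_le_quadratic[OF y[of x]] by (simp add: power2_eq_square algebra_simps)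
  qed (use ih ih2 in simp)
  also have "\<dots> = 1 + r\<^sup>2 * (expectation (\<lambda>x. (h x)\<^sup>2) - ?E\<^sup>2)"
    using ih ih2 by (simp add: prob_space power2_eq_square algebra_simps)
  also have "\<dots> \<le> 1 + r\<^sup>2 * B"
  proof -
    have "expectation (\<lambda>x. (h x)\<^sup>2) \<le> expectation (\<lambda>x. B * h x)"
      using h by (intro integral_mono ih2) (use ih h in \<open>auto simp: power2_eq_square intro: mult_right_mono\<close>)
    also have "\<dots> \<le> B * 1" using E E0 EB by (simp add: mult_left_le)
    finally have "expectation (\<lambda>x. (h x)\<^sup>2) - ?E\<^sup>2 \<le> B" by (smt (verit) zero_le_power2)
    then show ?thesis by (intro add_left_mono mult_left_mono) auto
  qed
  also have "\<dots> \<le> exp (r\<^sup>2 * B)" by (rule exp_ge_add_one_self)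
  finally show "expectation (\<lambda>x. exp (r * (h x - ?E))) \<le> exp (r\<^sup>2 * B)" .
qed

text \<open>An exponential Chebyshev inequality with a union bound. Each function enters with both
  signs, one for each tail; a total potential below \<open>1\<close> forces every single term below
  \<open>1\<close>, so no deviation exceeds \<open>\<eta>\<close>.\<close>

lemma (in prob_space) exists_sampling_points:
  fixes h :: "'i \<Rightarrow> 'a \<Rightarrow> real" and B :: "'i \<Rightarrow> real"
  assumes I: "finite I" and \<Omega>: "AE x in M. x \<in> \<Omega>"
    and meas: "\<And>i. i \<in> I \<Longrightarrow> h i \<in> borel_measurable M"
    and h: "\<And>i x. i \<in> I \<Longrightarrow> 0 \<le> h i x" "\<And>i x. i \<in> I \<Longrightarrow> h i x \<le> B i"
    and E: "\<And>i. i \<in> I \<Longrightarrow> expectation (h i) \<le> 1"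
    and B: "\<And>i. i \<in> I \<Longrightarrow> 0 < B i" and \<eta>: "0 < \<eta>" "\<eta> \<le> 1" and m: "0 < m"
    and sum: "(\<Sum>i\<in>I. 2 * exp (- (real m * \<eta>\<^sup>2 / (4 * B i)))) < 1"
  shows "\<exists>\<xi>::nat \<Rightarrow> 'a. (\<forall>j\<in>{1..m}. \<xi> j \<in> \<Omega>) \<and>
    (\<forall>i\<in>I. \<bar>(\<Sum>j=1..m. h i (\<xi> j)) / real m - expectation (h i)\<bar> \<le> \<eta>)"
proof -
  \<comment> \<open>This value minimizes \<open>- r * m * \<eta> + m * r\<^sup>2 * B i\<close>; the
    minimum is \<open>- m * \<eta>\<^sup>2 / (4 * B i)\<close>.\<close>
  define r where "r = (\<lambda>i. \<eta> / (2 * B i))"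
  define X where "X = (\<lambda>(i, \<sigma>::real) x. \<sigma> * r i * (h i x - expectation (h i)))"
  define a where "a = (\<lambda>(i, \<sigma>::real). exp (- (r i * real m * \<eta>)))"
  define \<rho> where "\<rho> = (\<lambda>(i, \<sigma>::real). exp ((r i)\<^sup>2 * B i))"
  let ?J = "I \<times> {1, -1::real}"
  have l: "\<bar>\<sigma> * r i\<bar> * B i \<le> 1" if "i \<in> I" "\<sigma> \<in> {1, -1}" for i \<sigma>
    using that B[of i] \<eta> by (auto simp: r_def abs_mult)
  have int: "integrable M (\<lambda>x. exp (X p x))" and ex: "expectation (\<lambda>x. exp (X p x)) \<le> \<rho> p"
    if "p \<in> ?J" for p
  proof -
    obtain i \<sigma> where p: "p = (i, \<sigma>)" "i \<in> I" "\<sigma> \<in> {1, -1}" using \<open>p \<in> ?J\<close> by auto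
    show "integrable M (\<lambda>x. exp (X p x))"
      unfolding p(1) X_def prod.case
      by (rule expectation_exp_centered_le(1)[where B="B i"]) (use p h meas E l in auto)
    have "expectation (\<lambda>x. exp (X p x)) \<le> exp ((\<sigma> * r i)\<^sup>2 * B i)"
      unfolding p(1) X_def prod.case
      by (rule expectation_exp_centered_le(2)) (use p h meas E l in auto)
    also have "\<dots> = \<rho> p" using p by (auto simp: \<rho>_def power_mult_distrib)
    finally show "expectation (\<lambda>x. exp (X p x)) \<le> \<rho> p" .
  qed
  obtain \<xi> where \<xi>: "\<forall>j\<in>{1..m}. \<xi> j \<in> \<Omega>"
    "(\<Sum>p\<in>?J. a p * exp (\<Sum>j=1..m. X p (\<xi> j))) \<le> (\<Sum>p\<in>?J. a p * \<rho> p ^ m)"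
    using exists_points_exp_sum_le[of ?J \<Omega> X \<rho> a m] I \<Omega> int ex by (auto simp: a_def)
  have "(\<Sum>p\<in>?J. a p * \<rho> p ^ m) = (\<Sum>i\<in>I. 2 * (exp (- (r i * real m * \<eta>)) * exp ((r i)\<^sup>2 * B i) ^ m))"
    by (simp add: sum.cartesian_product' a_def \<rho>_def)
  also have "\<dots> = (\<Sum>i\<in>I. 2 * exp (- (real m * \<eta>\<^sup>2 / (4 * B i))))"
  proof (rule sum.cong[OF refl])
    fix i assume "i \<in> I"
    then have "- (r i * real m * \<eta>) + real m * ((r i)\<^sup>2 * B i) = - (real m * \<eta>\<^sup>2 / (4 * B i))"
      using B[of i] by (simp add: r_def field_simps power2_eq_square)
    then show "2 * (exp (- (r i * real m * \<eta>)) * exp ((r i)\<^sup>2 * B i) ^ m) = 2 * exp (- (real m * \<eta>\<^sup>2 / (4 * B i)))"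
      by (simp add: exp_of_nat_mult[symmetric] exp_add[symmetric])
  qed
  finally have lt1: "(\<Sum>p\<in>?J. a p * exp (\<Sum>j=1..m. X p (\<xi> j))) < 1"
    using \<xi>(2) sum by simp
  have key: "\<sigma> * ((\<Sum>j=1..m. h i (\<xi> j)) / real m - expectation (h i)) \<le> \<eta>"
    if i: "i \<in> I" and s: "\<sigma> \<in> {1, -1}" for i \<sigma>
  proof -
    have "a (i, \<sigma>) * exp (\<Sum>j=1..m. X (i, \<sigma>) (\<xi> j)) \<le> (\<Sum>p\<in>?J. a p * exp (\<Sum>j=1..m. X p (\<xi> j)))"
      by (rule member_le_sum) (use i s I in \<open>auto simp: a_def\<close>)
    then have "exp (- (r i * real m * \<eta>) + (\<Sum>j=1..m. X (i, \<sigma>) (\<xi> j))) < 1"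
      using lt1 unfolding a_def exp_add prod.case by (rule le_less_trans)
    then have "(\<Sum>j=1..m. X (i, \<sigma>) (\<xi> j)) < r i * real m * \<eta>" by simp
    moreover have "(\<Sum>j=1..m. X (i, \<sigma>) (\<xi> j)) = r i * real m * (\<sigma> * ((\<Sum>j=1..m. h i (\<xi> j)) / real m - expectation (h i)))"
      using m by (simp add: X_def sum_distrib_left[symmetric] sum_subtractf field_simps)
    moreover have "0 < r i * real m" using m B[OF i] \<eta> by (simp add: r_def)
    ultimately show ?thesis by (metis mult_less_cancel_left_pos less_imp_le)
  qed
  have "\<bar>(\<Sum>j=1..m. h i (\<xi> j)) / real m - expectation (h i)\<bar> \<le> \<eta>" if "i \<in> I" for i
    using key[OF that, of 1] key[OF that, of "-1"] by (auto simp: abs_le_iff)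
  with \<xi>(1) show ?thesis by blast
qed

section \<open>Dyadic layers of a power\<close>

text \<open>The increase of the \<open>q\<close>-th power from \<open>b\<close> to \<open>v\<close>,
  with \<open>v\<close> truncated to the interval from \<open>b\<close> to \<open>2 * b\<close>. It
  vanishes below \<open>b\<close> and is constant above \<open>2 * b\<close>, so the layers at
  dyadic sizes telescope.\<close>

definition layer :: "real \<Rightarrow> real \<Rightarrow> real \<Rightarrow> real" where
  "layer q b v = min (max v b) (2 * b) powr q - b powr q"

context
  fixes q :: real
  assumes q: "1 \<le> q" "q \<le> 2"
begin

lemma two_powr_q_bounds: "2 \<le> (2::real) powr q" "(2::real) powr q \<le> 4"
  using powr_mono[of 1 q "2::real"] powr_mono[of q 2 "2::real"] q by auto

lemma layer_nonneg: "0 < b \<Longrightarrow> 0 \<le> layer q b v"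
  using q by (auto simp: layer_def intro!: powr_mono2)

lemma layer_le:
  assumes "0 < b"
  shows "layer q b v \<le> 3 * b powr q"
proof -
  have "min (max v b) (2 * b) powr q \<le> (2 * b) powr q"
    using assms q by (intro powr_mono2) auto
  also have "\<dots> \<le> 4 * b powr q"
    using assms two_powr_q_bounds by (simp add: powr_mult)
  finally show ?thesis by (simp add: layer_def)
qed

lemma layer_le_powr: "0 < b \<Longrightarrow> layer q b v \<le> v powr q"
proof -
  assume b: "0 < b"
  have "min (max v b) (2 * b) powr q \<le> max v b powr q"
    using b q by (intro powr_mono2) auto
  also have "\<dots> \<le> v powr q + b powr q" by (auto simp: max_def)
  finally show ?thesis by (simp add: layer_def)
qed

lemma layer_eq_0: "v \<le> b \<Longrightarrow> 0 < b \<Longrightarrow> layer q b v = 0"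
  by (simp add: layer_def max_def min_def)

lemma powr_diff_le:
  assumes b: "0 < b" "b \<le> x" "x \<le> y" "y \<le> 2 * b"
  shows "y powr q - x powr q \<le> 4 * b powr (q - 1) * (y - x)"
proof (cases "x = y")
  case False
  then have xy: "x < y" using b by simp
  have "\<exists>z. x < z \<and> z < y \<and> y powr q - x powr q = (y - x) * (q * z powr (q - 1))"
    using b by (intro MVT2[OF xy]) (auto intro!: derivative_eq_intros)
  then obtain z where z: "x < z" "z < y" "y powr q - x powr q = (y - x) * (q * z powr (q - 1))"
    by blast
  have "z powr (q - 1) \<le> (2 * b) powr (q - 1)"
    using z b q by (intro powr_mono2) auto
  also have "\<dots> = 2 powr (q - 1) * b powr (q - 1)" using b by (simp add: powr_mult)
  also have "\<dots> \<le> 2 * b powr (q - 1)"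
    using powr_mono[of "q - 1" 1 "2::real"] q by (intro mult_right_mono) auto
  finally have "q * z powr (q - 1) \<le> 2 * (2 * b powr (q - 1))"
    using q by (intro mult_mono) auto
  then have "(y - x) * (q * z powr (q - 1)) \<le> (y - x) * (4 * b powr (q - 1))"
    using xy by (intro mult_left_mono) auto
  then show ?thesis using z by (simp add: mult_ac)
qed simp

text \<open>Truncation is 1-Lipschitz, and on the interval from \<open>b\<close> to
  \<open>2 * b\<close> the \<open>q\<close>-th power has Lipschitz constant at most
  \<open>4 * b powr (q - 1)\<close>.\<close>

lemma layer_diff_le:
  assumes b: "0 < b" and vw: "\<bar>v - w\<bar> \<le> \<delta> * b"
  shows "\<bar>layer q b v - layer q b w\<bar> \<le> 4 * \<delta> * b powr q"
  using vw
proof (induction v w rule: linorder_wlog)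
  case (le v w)
  let ?c = "\<lambda>v. min (max v b) (2 * b)"
  have "?c v \<le> ?c w" using le by auto
  then have "layer q b w - layer q b v \<le> 4 * b powr (q - 1) * (?c w - ?c v)"
    using powr_diff_le[of b "?c v" "?c w"] b by (simp add: layer_def)
  also have "\<dots> \<le> 4 * b powr (q - 1) * (\<delta> * b)"
    using le by (intro mult_left_mono) auto
  also have "\<dots> = 4 * \<delta> * b powr q" using b by (simp add: powr_diff)
  finally have "layer q b w - layer q b v \<le> 4 * \<delta> * b powr q" .
  moreover have "layer q b v \<le> layer q b w"
    using \<open>?c v \<le> ?c w\<close> b q by (auto simp: layer_def intro!: powr_mono2)
  ultimately show ?case by simp
next
  case (sym v w)
  then show ?case by (simp add: abs_minus_commute)
qed

lemma sum_layer_eq: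
  assumes a: "0 < a"
  shows "(\<Sum>i<l. layer q (2 ^ i * a) v) = min (max v a) (2 ^ l * a) powr q - a powr q"
proof (induction l)
  case 0
  then show ?case using a by simp
next
  case (Suc l)
  define b where "b = 2 ^ l * a"
  have ab: "a \<le> b" using a by (simp add: b_def)
  have "layer q b v = min (max v a) (2 * b) powr q - min (max v a) b powr q"
    using a ab by (simp add: layer_def max_def min_def)
  then show ?case using Suc by (simp add: b_def mult.assoc)
qed

lemma sum_dyadic_powr_le:
  assumes a: "0 < a"
  shows "(\<Sum>i<l. (2 ^ i * a) powr q) \<le> (2 ^ l * a) powr q"
proof (induction l)
  case (Suc l)
  have "2 * (2 ^ l * a) powr q \<le> 2 powr q * (2 ^ l * a) powr q"
    by (intro mult_right_mono two_powr_q_bounds) auto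
  also have "\<dots> = (2 ^ Suc l * a) powr q" using a by (simp add: powr_mult)
  finally show ?case using Suc by simp
qed simp

text \<open>Consecutive terms grow by the factor \<open>2 powr q \<ge> 2\<close>, so a sum stopped
  at \<open>u\<close> is at most twice its last term.\<close>

lemma sum_dyadic_powr_truncated_le:
  assumes a: "0 < a"
  shows "(\<Sum>i<l. if 2 ^ i * a \<le> u then (2 ^ i * a) powr q else 0) \<le> 2 * u powr q"
proof (induction l)
  case (Suc l)
  show ?case
  proof (cases "2 ^ l * a \<le> u")
    case True
    have "(\<Sum>i<Suc l. if 2 ^ i * a \<le> u then (2 ^ i * a) powr q else 0) \<le> (\<Sum>i<Suc l. (2 ^ i * a) powr q)"
      by (intro sum_mono) auto
    also have "\<dots> \<le> 2 * (2 ^ l * a) powr q"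
      using sum_dyadic_powr_le[OF a, of l] by simp
    also have "\<dots> \<le> 2 * u powr q" using True a q by (simp add: powr_mono2)
    finally show ?thesis .
  qed (use Suc in simp)
qed simp

text \<open>Every layer may use its own approximation \<open>w i\<close>, with an error proportional
  to its size. Layers of size above \<open>2 * v\<close> vanish at both \<open>v\<close> and
  \<open>w i\<close>, so the errors add up geometrically to a multiple of \<open>v powr q\<close>
  that does not depend on the number of layers. The term \<open>a powr q\<close> covers what lies
  below the bottom layer.\<close>

lemma layer_decomposition:
  assumes a: "0 < a" and v: "0 \<le> v" "v \<le> 2 ^ l * a"
    and w: "\<And>i. i < l \<Longrightarrow> \<bar>v - w i\<bar> \<le> \<delta> * (2 ^ i * a)" and \<delta>: "0 \<le> \<delta>" "\<delta> \<le> 1 / 2"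
  shows "\<bar>v powr q - (\<Sum>i<l. layer q (2 ^ i * a) (w i))\<bar> \<le> 32 * \<delta> * v powr q + a powr q"
proof -
  have d: "\<bar>layer q (2 ^ i * a) v - layer q (2 ^ i * a) (w i)\<bar> \<le>
     4 * \<delta> * (if 2 ^ i * a \<le> 2 * v then (2 ^ i * a) powr q else 0)" if i: "i < l" for i
  proof (cases "2 ^ i * a \<le> 2 * v")
    case True
    then show ?thesis using layer_diff_le[OF _ w[OF i]] a by simp
  next
    case False
    \<comment> \<open>Here \<open>v\<close> is below half of the layer size, and
      \<open>\<delta> \<le> 1 / 2\<close> keeps \<open>w i\<close> below the layer size as
      well.\<close>
    have "\<delta> * (2 ^ i * a) \<le> 1 / 2 * (2 ^ i * a)" using \<delta> a by (intro mult_right_mono) auto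
    then have "v \<le> 2 ^ i * a" "w i \<le> 2 ^ i * a" using False w[OF i] v by linarith+
    then show ?thesis using False a by (simp add: layer_eq_0)
  qed
  have "\<bar>(\<Sum>i<l. layer q (2 ^ i * a) v) - (\<Sum>i<l. layer q (2 ^ i * a) (w i))\<bar>
     \<le> (\<Sum>i<l. \<bar>layer q (2 ^ i * a) v - layer q (2 ^ i * a) (w i)\<bar>)"
    unfolding sum_subtractf[symmetric] by (rule sum_abs)
  also have "\<dots> \<le> (\<Sum>i<l. 4 * \<delta> * (if 2 ^ i * a \<le> 2 * v then (2 ^ i * a) powr q else 0))"
    using d by (intro sum_mono) auto
  also have "\<dots> \<le> 4 * \<delta> * (2 * (2 * v) powr q)"
    unfolding sum_distrib_left[symmetric] using \<delta>
    by (intro mult_left_mono sum_dyadic_powr_truncated_le a) auto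
  also have "\<dots> \<le> 4 * \<delta> * (2 * (4 * v powr q))"
    using \<delta> v two_powr_q_bounds by (intro mult_left_mono) (auto simp: powr_mult intro!: mult_right_mono)
  finally have 1: "\<bar>(\<Sum>i<l. layer q (2 ^ i * a) v) - (\<Sum>i<l. layer q (2 ^ i * a) (w i))\<bar> \<le> 32 * \<delta> * v powr q"
    by simp
  have "min (max v a) (2 ^ l * a) = max v a" using v a by (auto simp: min_def max_def)
  then have "\<bar>v powr q - (\<Sum>i<l. layer q (2 ^ i * a) v)\<bar> \<le> a powr q"
    using v a q by (auto simp: sum_layer_eq[OF a] max_def intro!: powr_mono2)
  with 1 show ?thesis by linarith
qed

end

section \<open>Entropy of bounded orthonormal systems\<close>

text \<open>The set \<open>\<Omega>\<close> has full measure: uniform norms are taken over it and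
  sampling points are chosen from it. For the torus measure it is the half-open cube inside
  \<open>real ^ 'd\<close>.\<close>

locale bounded_orthonormal_system = prob_space M
  for M :: "'a measure" and e :: "'k \<Rightarrow> 'a \<Rightarrow> complex" and Q :: "'k set" and \<Omega> :: "'a set" +
  assumes finite_Q: "finite Q" and Q_nonempty: "Q \<noteq> {}"
    and e_measurable [measurable]: "\<And>k. k \<in> Q \<Longrightarrow> e k \<in> borel_measurable M"
    and cmod_e: "\<And>k x. k \<in> Q \<Longrightarrow> cmod (e k x) \<le> 1"
    and orthonormal: "\<And>k l. k \<in> Q \<Longrightarrow> l \<in> Q \<Longrightarrow> (\<integral>x. e k x * cnj (e l x) \<partial>M) = of_bool (k = l)"
    and AE_\<Omega>: "AE x in M. x \<in> \<Omega>"
begin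

definition lincomb :: "('k \<Rightarrow> complex) \<Rightarrow> 'a \<Rightarrow> complex" where
  "lincomb c x = (\<Sum>k\<in>Q. c k * e k x)"

text \<open>The squared \<open>L\<^sub>2\<close>-norm of \<open>lincomb c\<close>, by
  \<open>parseval\<close>.\<close>

definition energy :: "('k \<Rightarrow> complex) \<Rightarrow> real" where
  "energy c = (\<Sum>k\<in>Q. (cmod (c k))\<^sup>2)"

lemma lincomb_measurable [measurable]: "lincomb c \<in> borel_measurable M"
  unfolding lincomb_def by measurable

lemma lincomb_add: "lincomb (\<lambda>k. b k + c k) x = lincomb b x + lincomb c x"
  by (simp add: lincomb_def sum.distrib algebra_simps)

lemma lincomb_diff: "lincomb (\<lambda>k. b k - c k) x = lincomb b x - lincomb c x"
  by (simp add: lincomb_def sum_subtractf algebra_simps)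

lemma lincomb_scale: "lincomb (\<lambda>k. z * c k) x = z * lincomb c x"
  by (simp add: lincomb_def sum_distrib_left mult.assoc)

lemma energy_nonneg: "0 \<le> energy c"
  by (simp add: energy_def sum_nonneg)

lemma card_Q_pos: "0 < card Q"
  using finite_Q Q_nonempty by (simp add: card_gt_0_iff)

lemma \<Omega>_nonempty: "\<Omega> \<noteq> {}"
  using AE_\<Omega> by (auto simp: AE_False)

lemma cmod_lincomb_le_sum: "cmod (lincomb c x) \<le> (\<Sum>k\<in>Q. cmod (c k))"
  unfolding lincomb_def
  by (rule order_trans[OF norm_sum]) (auto simp: norm_mult cmod_e intro!: sum_mono mult_left_le)

lemma sum_cmod_le: "(\<Sum>k\<in>Q. cmod (c k))\<^sup>2 \<le> card Q * energy c"
  using sum_squared_le_sum_of_squares[of "\<lambda>k. cmod (c k)" Q] by (simp add: energy_def mult.commute)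

lemma cmod_lincomb_sq_le: "(cmod (lincomb c x))\<^sup>2 \<le> card Q * energy c"
  by (rule order_trans[OF power_mono sum_cmod_le]) (auto simp: cmod_lincomb_le_sum)

text \<open>The values of \<open>lincomb c\<close> stay in a fixed closed disc, on which
  \<open>F\<close> is bounded by compactness.\<close>

lemma integrable_continuous_lincomb:
  fixes F :: "complex \<Rightarrow> real"
  assumes F: "continuous_on UNIV F"
  shows "integrable M (\<lambda>x. F (lincomb c x))"
proof -
  have [measurable]: "F \<in> borel_measurable borel"
    using F by (rule borel_measurable_continuous_onI)
  let ?K = "cball (0::complex) (\<Sum>k\<in>Q. cmod (c k))"
  have "compact (F ` ?K)"
    by (intro compact_continuous_image continuous_on_subset[OF F]) auto
  then obtain B where "\<And>z. z \<in> ?K \<Longrightarrow> norm (F z) \<le> B"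
    using compact_imp_bounded bounded_iff by (metis imageI)
  then show ?thesis
    by (intro integrable_const_bound[where B=B]) (auto simp: cmod_lincomb_le_sum)
qed

lemma parseval: "expectation (\<lambda>x. (cmod (lincomb c x))\<^sup>2) = energy c"
proof -
  have int: "integrable M (\<lambda>x. c k * e k x * (cnj (c l) * cnj (e l x)))" if "k \<in> Q" "l \<in> Q" for k l
  proof (rule integrable_const_bound[where B="cmod (c k) * cmod (c l)"])
    show "AE x in M. norm (c k * e k x * (cnj (c l) * cnj (e l x))) \<le> cmod (c k) * cmod (c l)"
      using that by (auto simp: norm_mult cmod_e intro!: mult_mono mult_left_le)
  qed (use that in \<open>auto intro!: borel_measurable_times borel_measurable_continuous_on[OF continuous_on_cnj[OF continuous_on_id]] e_measurable\<close>)
  have "complex_of_real (expectation (\<lambda>x. (cmod (lincomb c x))\<^sup>2))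
      = expectation (\<lambda>x. complex_of_real ((cmod (lincomb c x))\<^sup>2))"
    by (rule integral_complex_of_real[symmetric])
  also have "\<dots> = expectation (\<lambda>x. \<Sum>k\<in>Q. \<Sum>l\<in>Q. c k * e k x * (cnj (c l) * cnj (e l x)))"
    unfolding complex_norm_square lincomb_def cnj_sum complex_cnj_mult by (simp only: sum_product)
  also have "\<dots> = (\<Sum>k\<in>Q. \<Sum>l\<in>Q. c k * cnj (c l) * (\<integral>x. e k x * cnj (e l x) \<partial>M))"
  proof -
    have "(\<integral>x. c k * e k x * (cnj (c l) * cnj (e l x)) \<partial>M) = c k * cnj (c l) * (\<integral>x. e k x * cnj (e l x) \<partial>M)" for k l
      by (subst integral_mult_right_zero[symmetric]) (simp add: mult_ac)
    then show ?thesis using int by (simp add: integral_sum)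
  qed
  also have "\<dots> = (\<Sum>k\<in>Q. \<Sum>l\<in>Q. if k = l then c k * cnj (c k) else 0)"
    by (intro sum.cong refl) (simp add: orthonormal)
  also have "\<dots> = complex_of_real (energy c)"
    using finite_Q by (simp add: energy_def complex_norm_square del: of_real_power)
  finally show ?thesis by (simp only: of_real_eq_iff)
qed

text \<open>With \<open>S\<close> the supremum over \<open>\<Omega>\<close>, the
  \<open>L\<^sub>2\<close>-norm is at most \<open>S\<close>, so density gives
  \<open>S \<le> t + S / 2\<close>.\<close>

lemma norming_if_dense:
  assumes dense: "\<And>x. x \<in> \<Omega> \<Longrightarrow> \<exists>y\<in>\<Lambda>. cmod (lincomb c x - lincomb c y) \<le> 1 / 2 * sqrt (energy c)"
    and le: "\<And>y. y \<in> \<Lambda> \<Longrightarrow> cmod (lincomb c y) \<le> t" and x: "x \<in> \<Omega>"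
  shows "cmod (lincomb c x) \<le> 2 * t"
proof -
  define S where "S = (SUP y\<in>\<Omega>. cmod (lincomb c y))"
  have bdd: "bdd_above ((\<lambda>y. cmod (lincomb c y)) ` \<Omega>)"
    by (auto intro!: bdd_aboveI2 cmod_lincomb_le_sum)
  have S: "cmod (lincomb c y) \<le> S" if "y \<in> \<Omega>" for y
    unfolding S_def using bdd that by (rule cSUP_upper2) simp
  have S0: "0 \<le> S" using S[OF x] norm_ge_zero order_trans by blast
  have "expectation (\<lambda>x. (cmod (lincomb c x))\<^sup>2) \<le> expectation (\<lambda>_. S\<^sup>2)"
  proof (rule integral_mono_AE)
    show "AE x in M. (cmod (lincomb c x))\<^sup>2 \<le> S\<^sup>2"
      using AE_\<Omega> by eventually_elim (intro power_mono S, auto)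
  qed (intro integrable_continuous_lincomb continuous_intros, simp)
  then have "energy c \<le> S\<^sup>2" by (simp add: parseval prob_space)
  then have E: "sqrt (energy c) \<le> S" using S0 by (simp add: real_le_lsqrt)
  have "S \<le> t + 1 / 2 * S"
    unfolding S_def
  proof (rule cSUP_least[OF \<Omega>_nonempty])
    fix y assume "y \<in> \<Omega>"
    then obtain z where z: "z \<in> \<Lambda>" "cmod (lincomb c y - lincomb c z) \<le> 1 / 2 * sqrt (energy c)"
      using dense by blast
    have "cmod (lincomb c y) \<le> cmod (lincomb c z) + cmod (lincomb c y - lincomb c z)"
      by (rule norm_triangle_sub)
    then show "cmod (lincomb c y) \<le> t + 1 / 2 * (SUP y\<in>\<Omega>. cmod (lincomb c y))"
      using le[OF z(1)] z(2) E unfolding S_def by linarith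
  qed
  then show ?thesis using S[OF x] by simp
qed

text \<open>Greedy approximation: as long as some sample of the residual exceeds \<open>t\<close>, subtracting a multiple of
  the reproducing kernel at that sample decreases the energy by \<open>t\<^sup>2 / (2 * card Q)\<close>. Hence a residual is
  determined, up to \<open>t\<close>, by a short word in the kernels.\<close>

lemma finite_cover_samples:
  assumes \<Lambda>: "finite \<Lambda>" and t: "0 < t"
  shows "\<exists>Y. finite Y \<and> card Y \<le> (4 * card \<Lambda> + 1) ^ K \<and> (\<lambda>_. 0) \<in> Y \<and>
    (\<forall>c. energy c \<le> real K * (t\<^sup>2 / (2 * card Q)) \<longrightarrow>
       (\<exists>y\<in>Y. \<forall>x\<in>\<Lambda>. cmod (lincomb c x - lincomb y x) \<le> t))"
proof (induction K)
  case 0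
  have "lincomb c x = lincomb (\<lambda>_. 0) x" if "energy c \<le> 0" for c x
  proof -
    have "energy c = 0" using that energy_nonneg[of c] by simp
    then show ?thesis using finite_Q by (simp add: lincomb_def energy_def sum_nonneg_eq_0_iff)
  qed
  then show ?case using t by (intro exI[of _ "{\<lambda>_. 0}"]) auto
next
  case (Suc K)
  define N where "N = real (card Q)"
  have N: "0 < N" using card_Q_pos by (simp add: N_def)
  \<comment> \<open>The step length that minimizes the energy change
    \<open>- 2 * s * (t / sqrt 2) + N * s\<^sup>2\<close>, with minimum
    \<open>- t\<^sup>2 / (2 * N)\<close>.\<close>
  define s where "s = t / (sqrt 2 * N)"
  have s: "0 < s" using t N by (simp add: s_def)
  \<comment> \<open>Four directions replace the exact phase of the sample, so that each step has
    finitely many choices; this costs the factor \<open>sqrt 2\<close>.\<close>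
  let ?W = "{1, -1, \<i>, -\<i>}"
  \<comment> \<open>\<open>None\<close> is the empty step. It keeps the zero combination in the
    cover, which serves residuals that are already at most \<open>t\<close>.\<close>
  define P where "P = insert None (Some ` (\<Lambda> \<times> ?W))"
  define v where "v = (\<lambda>p k. case p of None \<Rightarrow> 0 | Some (x, w) \<Rightarrow> complex_of_real s * cnj (w * e k x))"
  obtain Y where Y: "finite Y" "card Y \<le> (4 * card \<Lambda> + 1) ^ K" "(\<lambda>_. 0) \<in> Y"
    "\<And>c. energy c \<le> real K * (t\<^sup>2 / (2 * N)) \<Longrightarrow> \<exists>y\<in>Y. \<forall>x\<in>\<Lambda>. cmod (lincomb c x - lincomb y x) \<le> t"
    using Suc by (auto simp: N_def)
  define Y' where "Y' = (\<lambda>(y, p) k. y k + v p k) ` (Y \<times> P)"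
  have finP: "finite P" using \<Lambda> by (simp add: P_def)
  have "card (Some ` (\<Lambda> \<times> ?W)) \<le> card \<Lambda> * card ?W"
    using \<Lambda> by (metis card_image_le card_cartesian_product finite.emptyI finite_SigmaI finite_insert)
  also have "\<dots> \<le> card \<Lambda> * 4" by (intro mult_left_mono) (auto simp: card_insert_if)
  finally have cardP: "card P \<le> 4 * card \<Lambda> + 1"
    using \<Lambda> by (simp add: P_def card_insert_if)
  have step: "energy (\<lambda>k. c k - v (Some (x, w)) k) \<le> energy c - t\<^sup>2 / (2 * N)"
    if w: "w \<in> ?W" and big: "t / sqrt 2 \<le> Re (w * lincomb c x)" for c x w
  proof -
    have cw: "cmod w = 1" using w by auto
    have pt: "(cmod (c k - v (Some (x, w)) k))\<^sup>2 \<le>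
        (cmod (c k))\<^sup>2 - 2 * s * Re (w * (c k * e k x)) + s\<^sup>2" if k: "k \<in> Q" for k
    proof -
      have "(cmod (c k - v (Some (x, w)) k))\<^sup>2
          = (cmod (c k))\<^sup>2 - 2 * Re (c k * cnj (v (Some (x, w)) k)) + (cmod (v (Some (x, w)) k))\<^sup>2"
        unfolding cmod_power2 by (simp add: power2_eq_square algebra_simps)
      moreover have "Re (c k * cnj (v (Some (x, w)) k)) = s * Re (w * (c k * e k x))"
        by (simp add: v_def algebra_simps)
      moreover have "cmod (v (Some (x, w)) k) \<le> s"
        using k s cw cmod_e[of k x] by (simp add: v_def norm_mult mult_left_le)
      then have "(cmod (v (Some (x, w)) k))\<^sup>2 \<le> s\<^sup>2" by (intro power_mono) auto
      ultimately show ?thesis by (simp only: mult.assoc)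
    qed
    have "energy (\<lambda>k. c k - v (Some (x, w)) k)
        \<le> (\<Sum>k\<in>Q. (cmod (c k))\<^sup>2 - 2 * s * Re (w * (c k * e k x)) + s\<^sup>2)"
      unfolding energy_def by (intro sum_mono pt)
    also have "\<dots> = energy c - 2 * s * Re (w * lincomb c x) + N * s\<^sup>2"
      by (simp add: energy_def lincomb_def N_def sum.distrib sum_subtractf sum_distrib_left
        Re_sum mult.assoc del: times_complex.sel)
    also have "\<dots> \<le> energy c - 2 * s * (t / sqrt 2) + N * s\<^sup>2"
      using mult_left_mono[OF big, of "2 * s"] s by linarith
    also have "\<dots> = energy c - t\<^sup>2 / (2 * N)"
    proof -
      have "2 * s * (t / sqrt 2) = t\<^sup>2 / N" "N * s\<^sup>2 = t\<^sup>2 / (2 * N)"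
        using N by (auto simp: s_def power2_eq_square field_simps)
      then show ?thesis by (simp add: field_simps)
    qed
    finally show ?thesis .
  qed
  \<comment> \<open>One of \<open>Re z\<close>, \<open>Im z\<close> has modulus at least
    \<open>cmod z / sqrt 2\<close>, and the four directions pick out both coordinates with both
    signs.\<close>
  have dir: "\<exists>w\<in>?W. t / sqrt 2 \<le> Re (w * z)" if z: "t < cmod z" for z
  proof (rule ccontr)
    assume "\<not> ?thesis"
    then have "\<bar>Re z\<bar> \<le> t / sqrt 2" "\<bar>Im z\<bar> \<le> t / sqrt 2"
      by (auto simp: abs_le_iff)
    then have "\<bar>Re z\<bar>\<^sup>2 \<le> (t / sqrt 2)\<^sup>2" "\<bar>Im z\<bar>\<^sup>2 \<le> (t / sqrt 2)\<^sup>2"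
      by (simp_all only: power_mono abs_ge_zero)
    then have "(cmod z)\<^sup>2 \<le> t\<^sup>2" by (simp add: cmod_power2 power_divide)
    moreover have "t\<^sup>2 < (cmod z)\<^sup>2" using z t by (intro power_strict_mono) auto
    ultimately show False by simp
  qed
  have "\<exists>y\<in>Y'. \<forall>x\<in>\<Lambda>. cmod (lincomb c x - lincomb y x) \<le> t"
    if c: "energy c \<le> real (Suc K) * (t\<^sup>2 / (2 * N))" for c
  proof (cases "\<forall>x\<in>\<Lambda>. cmod (lincomb c x) \<le> t")
    case True
    have "(\<lambda>_. 0) \<in> Y'"
      unfolding Y'_def using Y(3) by (intro image_eqI[of _ _ "(\<lambda>_. 0, None)"]) (auto simp: v_def P_def)
    moreover have "lincomb (\<lambda>_. 0) x = 0" for x by (simp add: lincomb_def)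
    ultimately show ?thesis using True by (intro bexI[of _ "\<lambda>_. 0"]) auto
  next
    case False
    then obtain x where x: "x \<in> \<Lambda>" "t < cmod (lincomb c x)" by (auto simp: not_le)
    then obtain w where w: "w \<in> ?W" "t / sqrt 2 \<le> Re (w * lincomb c x)" using dir by meson
    let ?p = "Some (x, w)"
    have "energy (\<lambda>k. c k - v ?p k) \<le> real K * (t\<^sup>2 / (2 * N))"
      using step[OF w] c unfolding of_nat_Suc distrib_right mult_1_left by linarith
    then obtain y where y: "y \<in> Y" "\<forall>x\<in>\<Lambda>. cmod (lincomb (\<lambda>k. c k - v ?p k) x - lincomb y x) \<le> t"
      using Y(4) by blast
    have "(\<lambda>k. y k + v ?p k) \<in> Y'"
      unfolding Y'_def using y(1) x(1) w(1)
      by (intro image_eqI[of _ _ "(y, ?p)"]) (auto simp: P_def)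
    moreover have "lincomb c x - lincomb (\<lambda>k. y k + v ?p k) x = lincomb (\<lambda>k. c k - v ?p k) x - lincomb y x" for x
      by (simp add: lincomb_add lincomb_diff)
    ultimately show ?thesis using y(2) by (metis (no_types, lifting))
  qed
  moreover have "(\<lambda>_. 0) \<in> Y'"
    unfolding Y'_def using Y(3) by (intro image_eqI[of _ _ "(\<lambda>_. 0, None)"]) (auto simp: v_def P_def)
  moreover have "finite Y'" using Y(1) finP by (simp add: Y'_def)
  moreover have "card Y' \<le> (4 * card \<Lambda> + 1) ^ Suc K"
  proof -
    have "card Y' \<le> card Y * card P"
      unfolding Y'_def card_cartesian_product[symmetric] using Y(1) finP by (intro card_image_le) auto
    also have "\<dots> \<le> (4 * card \<Lambda> + 1) ^ K * (4 * card \<Lambda> + 1)"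
      using Y(2) cardP by (intro mult_mono) auto
    finally show ?thesis by (simp add: mult.commute)
  qed
  ultimately show ?case unfolding N_def of_nat_mult by auto
qed

end

section \<open>Uniform entropy of the unit ball of \<open>L\<^sub>q\<close>\<close>

text \<open>The finite set \<open>\<Lambda>\<close> is norming: values on it control those on
  \<open>\<Omega>\<close> up to the factor \<open>2\<close>. As \<open>exp L\<close> bounds the
  number of choices in one greedy step, \<open>L\<close> is the entropy cost per step.\<close>

locale sampled_orthonormal_system = bounded_orthonormal_system M e Q \<Omega>
  for M :: "'a measure" and e :: "'k \<Rightarrow> 'a \<Rightarrow> complex" and Q \<Omega> +
  fixes q :: real and \<Lambda> :: "'a set" and L :: real
  assumes q: "1 \<le> q" "q \<le> 2"
    and finite_\<Lambda>: "finite \<Lambda>"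
    and norming: "\<And>c t x. 0 \<le> t \<Longrightarrow> (\<And>y. y \<in> \<Lambda> \<Longrightarrow> cmod (lincomb c y) \<le> t) \<Longrightarrow> x \<in> \<Omega> \<Longrightarrow> cmod (lincomb c x) \<le> 2 * t"
    and L: "real (4 * card \<Lambda> + 1) \<le> exp L"
begin

definition mass :: "('k \<Rightarrow> complex) \<Rightarrow> real" where
  "mass c = expectation (\<lambda>x. cmod (lincomb c x) powr q)"

lemma L_nonneg: "0 \<le> L"
proof -
  have "1 \<le> exp L" using L by linarith
  then show ?thesis by simp
qed

lemma integrable_mass: "integrable M (\<lambda>x. cmod (lincomb c x) powr q)"
  using q by (intro integrable_continuous_lincomb continuous_on_powr' continuous_intros) auto

lemma mass_nonneg: "0 \<le> mass c"
  unfolding mass_def by (intro integral_nonneg_AE) simp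

lemma energy_le_mass:
  assumes t: "0 < t" "\<And>x. x \<in> \<Omega> \<Longrightarrow> cmod (lincomb c x) \<le> t"
  shows "energy c \<le> t powr (2 - q) * mass c"
proof -
  have "energy c \<le> expectation (\<lambda>x. t powr (2 - q) * cmod (lincomb c x) powr q)"
    unfolding parseval[symmetric]
  proof (rule integral_mono_AE)
    show "integrable M (\<lambda>x. (cmod (lincomb c x))\<^sup>2)"
      by (intro integrable_continuous_lincomb continuous_intros)
    show "AE x in M. (cmod (lincomb c x))\<^sup>2 \<le> t powr (2 - q) * cmod (lincomb c x) powr q"
      using AE_\<Omega>
    proof eventually_elim
      case (elim x)
      show ?case
      proof (cases "lincomb c x = 0")
        case False
        then have "(cmod (lincomb c x))\<^sup>2 = cmod (lincomb c x) powr (2 - q) * cmod (lincomb c x) powr q"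
          by (simp add: powr_add[symmetric])
        also have "\<dots> \<le> t powr (2 - q) * cmod (lincomb c x) powr q"
          using q t elim by (intro mult_right_mono powr_mono2) auto
        finally show ?thesis .
      qed simp
    qed
  qed (use integrable_mass in simp)
  then show ?thesis by (simp add: mass_def)
qed

text \<open>A Nikolskii inequality. With \<open>S\<close> the supremum over \<open>\<Omega>\<close>,
  one has \<open>S\<^sup>2 \<le> card Q * energy c \<le> card Q * S powr (2 - q)\<close>, and the
  common power of \<open>S\<close> cancels.\<close>

lemma nikolskii:
  assumes c: "mass c \<le> 1" and x: "x \<in> \<Omega>"
  shows "cmod (lincomb c x) powr q \<le> card Q"
proof (cases "lincomb c x = 0")
  case False
  define S where "S = (SUP y\<in>\<Omega>. cmod (lincomb c y))"
  have bdd: "bdd_above ((\<lambda>y. cmod (lincomb c y)) ` \<Omega>)"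
    by (auto intro!: bdd_aboveI2 cmod_lincomb_le_sum)
  have le: "cmod (lincomb c y) \<le> S" if "y \<in> \<Omega>" for y
    unfolding S_def using bdd that by (rule cSUP_upper2) simp
  have S: "0 < S" using False le[OF x] by (metis less_le_trans zero_less_norm_iff)
  have "cmod (lincomb c y) \<le> sqrt (card Q * energy c)" for y
    using cmod_lincomb_sq_le by (simp add: real_le_rsqrt)
  then have "S \<le> sqrt (card Q * energy c)"
    unfolding S_def using \<Omega>_nonempty by (intro cSUP_least) auto
  then have "S\<^sup>2 \<le> card Q * energy c"
    using S by (metis abs_of_pos real_sqrt_abs real_sqrt_le_iff)
  also have "\<dots> \<le> card Q * (S powr (2 - q) * mass c)"
    using energy_le_mass[OF S le] by (intro mult_left_mono) auto
  also have "\<dots> \<le> card Q * (S powr (2 - q) * 1)"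
    using c by (intro mult_left_mono) auto
  finally have "S powr (2 - q) * S powr q \<le> S powr (2 - q) * card Q"
    using S by (simp add: powr_add[symmetric] mult.commute)
  then have "S powr q \<le> card Q" using S by simp
  moreover have "cmod (lincomb c x) powr q \<le> S powr q"
    using le[OF x] q by (intro powr_mono2) auto
  ultimately show ?thesis by simp
qed simp

lemma mass_diff_le: "mass (\<lambda>k. b k - c k) \<le> 4 * (mass b + mass c)"
proof -
  have "mass (\<lambda>k. b k - c k) \<le> expectation (\<lambda>x. 4 * (cmod (lincomb b x) powr q + cmod (lincomb c x) powr q))"
    unfolding mass_def
  proof (intro integral_mono integrable_mass)
    fix x
    let ?m = "max (cmod (lincomb b x)) (cmod (lincomb c x))"
    have "cmod (lincomb (\<lambda>k. b k - c k) x) \<le> 2 * ?m"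
      unfolding lincomb_diff by (rule order_trans[OF norm_triangle_ineq4]) auto
    then have "cmod (lincomb (\<lambda>k. b k - c k) x) powr q \<le> (2 * ?m) powr q"
      using q by (intro powr_mono2) auto
    also have "\<dots> \<le> 4 * ?m powr q"
      using two_powr_q_bounds[OF q] by (simp add: powr_mult mult_right_mono)
    also have "?m powr q \<le> cmod (lincomb b x) powr q + cmod (lincomb c x) powr q"
      by (auto simp: max_def)
    finally show "cmod (lincomb (\<lambda>k. b k - c k) x) powr q \<le> 4 * (cmod (lincomb b x) powr q + cmod (lincomb c x) powr q)"
      by simp
  qed (use integrable_mass in simp)
  also have "\<dots> = 4 * (mass b + mass c)"
    using integrable_mass by (simp add: mass_def)
  finally show ?thesis .
qed

text \<open>A uniform net of the unit ball of \<open>L\<^sub>q\<close>. Its elements are required to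
  lie in the ball themselves, so that \<open>mass_diff_le\<close> bounds the difference of a
  function and its net element.\<close>

definition covers :: "real \<Rightarrow> ('k \<Rightarrow> complex) set \<Rightarrow> bool" where
  "covers t A \<longleftrightarrow> finite A \<and> (\<forall>a\<in>A. mass a \<le> 1) \<and>
    (\<forall>c. mass c \<le> 1 \<longrightarrow> (\<exists>a\<in>A. \<forall>x\<in>\<Omega>. cmod (lincomb c x - lincomb a x) \<le> t))"

text \<open>Two elements of the unit ball of \<open>L\<^sub>q\<close> at uniform distance \<open>2 * t\<close> have \<open>L\<^sub>2\<close>-distance at most
  about \<open>t powr (1 - q / 2)\<close>, so the greedy approximation refines a \<open>2 * t\<close>-net to a \<open>t\<close>-net.\<close>

lemma covers_refine:
  assumes A: "covers (2 * t) A" and t: "0 < t"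
    and K: "512 * real (card Q) * t powr (- q) \<le> real K"
  shows "\<exists>A'. covers t A' \<and> card A' \<le> card A * (4 * card \<Lambda> + 1) ^ K"
proof -
  define N where "N = real (card Q)"
  have N: "0 < N" using card_Q_pos by (simp add: N_def)
  obtain Y where Y: "finite Y" "card Y \<le> (4 * card \<Lambda> + 1) ^ K"
    "\<And>c. energy c \<le> real K * ((t / 4)\<^sup>2 / (2 * N)) \<Longrightarrow> \<exists>y\<in>Y. \<forall>x\<in>\<Lambda>. cmod (lincomb c x - lincomb y x) \<le> t / 4"
    using finite_cover_samples[OF finite_\<Lambda>, of "t / 4" K] t by (auto simp: N_def)
  \<comment> \<open>A pair \<open>(a, y)\<close> describes a neighbourhood of \<open>a + y\<close>,
    which may itself lie outside the unit ball. Each nonempty neighbourhood is represented by one of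
    its own elements, which keeps the new net in the ball.\<close>
  define near where "near = (\<lambda>c (a, y). mass c \<le> 1 \<and> (\<forall>x\<in>\<Lambda>. cmod (lincomb c x - lincomb a x - lincomb y x) \<le> t / 4))"
  define rep where "rep = (\<lambda>p. SOME c. near c p)"
  define A' where "A' = rep ` {p \<in> A \<times> Y. \<exists>c. near c p}"
  have finA: "finite A" and mA: "\<And>a. a \<in> A \<Longrightarrow> mass a \<le> 1"
    and cov: "\<And>c. mass c \<le> 1 \<Longrightarrow> \<exists>a\<in>A. \<forall>x\<in>\<Omega>. cmod (lincomb c x - lincomb a x) \<le> 2 * t"
    using A by (auto simp: covers_def)
  have rep: "near (rep p) p" if "near c p" for c p
    unfolding rep_def using that by (rule someI[of "\<lambda>c. near c p"])
  have "\<exists>a\<in>A'. \<forall>x\<in>\<Omega>. cmod (lincomb c x - lincomb a x) \<le> t" if c: "mass c \<le> 1" for c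
  proof -
    obtain a where a: "a \<in> A" "\<And>x. x \<in> \<Omega> \<Longrightarrow> cmod (lincomb c x - lincomb a x) \<le> 2 * t"
      using cov[OF c] by blast
    let ?h = "\<lambda>k. c k - a k"
    have "energy ?h \<le> (2 * t) powr (2 - q) * mass ?h"
      using a t by (intro energy_le_mass) (auto simp: lincomb_diff)
    also have "\<dots> \<le> (2 * t) powr (2 - q) * 8"
      using mass_diff_le[of c a] c mA[OF a(1)] by (intro mult_left_mono) auto
    also have "(2 * t) powr (2 - q) \<le> 2 * t powr (2 - q)"
      using powr_mono[of "2 - q" 1 "2::real"] q t by (simp add: powr_mult mult_right_mono)
    finally have "energy ?h \<le> 16 * t powr (2 - q)" by simp
    \<comment> \<open>With accuracy \<open>t / 4\<close> one greedy step lowers the energy by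
      \<open>t\<^sup>2 / (32 * N)\<close>, and \<open>16 * 32 = 512\<close>.\<close>
    also have "\<dots> = 512 * N * t powr (- q) * ((t / 4)\<^sup>2 / (2 * N))"
      using N t by (simp add: powr_diff powr_minus field_simps power2_eq_square)
    also have "\<dots> \<le> real K * ((t / 4)\<^sup>2 / (2 * N))"
      using K N by (intro mult_right_mono) (auto simp: N_def)
    finally obtain y where y: "y \<in> Y" "\<forall>x\<in>\<Lambda>. cmod (lincomb ?h x - lincomb y x) \<le> t / 4"
      using Y(3) by blast
    then have near: "near c (a, y)" using c by (simp add: near_def lincomb_diff)
    let ?a = "rep (a, y)"
    have "?a \<in> A'" unfolding A'_def using a(1) y(1) near by auto
    moreover have "cmod (lincomb c x - lincomb ?a x) \<le> t" if x: "x \<in> \<Omega>" for x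
    proof -
      \<comment> \<open>On \<open>\<Lambda>\<close> both \<open>c\<close> and its representative are
        within \<open>t / 4\<close> of \<open>a + y\<close>, hence within \<open>t / 2\<close> of
        each other; norming doubles this to \<open>t\<close>.\<close>
      have "cmod (lincomb (\<lambda>k. c k - ?a k) x) \<le> 2 * (t / 2)"
      proof (rule norming[OF _ _ x])
        fix z assume z: "z \<in> \<Lambda>"
        have "cmod (lincomb c z - lincomb a z - lincomb y z) \<le> t / 4"
          "cmod (lincomb ?a z - lincomb a z - lincomb y z) \<le> t / 4"
          using z near rep[OF near] by (auto simp: near_def)
        then have "cmod ((lincomb c z - lincomb a z - lincomb y z) - (lincomb ?a z - lincomb a z - lincomb y z)) \<le> t / 4 + t / 4"
          by (meson add_mono norm_triangle_ineq4 order_trans)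
        then show "cmod (lincomb (\<lambda>k. c k - ?a k) z) \<le> t / 2" by (simp add: lincomb_diff)
      qed (use t in simp)
      then show ?thesis by (simp add: lincomb_diff)
    qed
    ultimately show ?thesis by blast
  qed
  moreover have "mass a \<le> 1" if "a \<in> A'" for a
    using that rep by (auto simp: A'_def near_def)
  ultimately have "covers t A'"
    using finA Y(1) by (auto simp: covers_def A'_def)
  moreover have "card A' \<le> card A * card Y"
    unfolding A'_def card_cartesian_product[symmetric] using finA Y(1)
    by (intro order_trans[OF card_image_le] card_mono) auto
  ultimately show ?thesis
    using Y(2) by (meson mult_le_mono2 order_trans)
qed

lemma covers_trivial:
  assumes "0 < t" "card Q \<le> t powr q"
  shows "covers t {\<lambda>_. 0}"
proof -
  have "cmod (lincomb c x) \<le> t" if "mass c \<le> 1" "x \<in> \<Omega>" for c x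
  proof (rule ccontr)
    assume "\<not> cmod (lincomb c x) \<le> t"
    then have "t powr q < cmod (lincomb c x) powr q"
      using q assms by (intro powr_less_mono2) auto
    then show False using nikolskii[OF that] assms by simp
  qed
  then show ?thesis
    using q by (simp add: covers_def mass_def lincomb_def)
qed

text \<open>Induction on the number of halvings from a scale at which zero alone is a net. As
  \<open>2 powr (- q) \<le> 1 / 2\<close>, the net at scale \<open>2 * t\<close> uses at most half
  of the exponent, and the refinement uses at most the other half.\<close>

lemma entropy_bound_aux:
  assumes "0 < t" and "card Q \<le> (2 ^ i * t) powr q"
  shows "\<exists>A. covers t A \<and> real (card A) \<le> exp (1026 * real (card Q) * t powr (- q) * L)"
  using assms
proof (induction i arbitrary: t)
  case (0 t)
  then show ?case using covers_trivial[of t] L_nonneg by (intro exI[of _ "{\<lambda>_. 0}"]) auto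
next
  case (Suc i t)
  show ?case
  proof (cases "card Q \<le> t powr q")
    case True
    then show ?thesis using covers_trivial[of t] Suc.prems L_nonneg by (intro exI[of _ "{\<lambda>_. 0}"]) auto
  next
    case False
    define X where "X = card Q * t powr (- q)"
    have X: "1 \<le> X" using False Suc.prems by (simp add: X_def powr_minus divide_simps)
    have "real (card Q) \<le> (2 ^ i * (2 * t)) powr q" using Suc.prems by (simp add: mult_ac)
    then obtain A where A: "covers (2 * t) A" "real (card A) \<le> exp (1026 * real (card Q) * (2 * t) powr (- q) * L)"
      using Suc.IH[of "2 * t"] Suc.prems by auto
    have "2 powr (- q) \<le> (1 / 2 :: real)"
      using two_powr_q_bounds(1)[OF q] by (simp add: powr_minus divide_simps)
    then have "2 powr (- q) * (1026 * X * L) \<le> 1 / 2 * (1026 * X * L)"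
      using L_nonneg X by (intro mult_right_mono) auto
    then have "1026 * real (card Q) * (2 * t) powr (- q) * L \<le> 513 * X * L"
      using Suc.prems by (simp add: X_def powr_mult mult_ac)
    with A(2) have cA: "real (card A) \<le> exp (513 * X * L)"
      by (meson exp_le_cancel_iff order_trans)
    \<comment> \<open>Since \<open>1 \<le> X\<close>, rounding up costs at most one further
      \<open>X\<close>.\<close>
    define K where "K = nat \<lceil>512 * X\<rceil>"
    have K: "512 * X \<le> real K" "real K \<le> 513 * X" using X unfolding K_def by linarith+
    obtain A' where A': "covers t A'" "card A' \<le> card A * (4 * card \<Lambda> + 1) ^ K"
      using covers_refine[OF A(1) Suc.prems(1), of K] K by (auto simp: X_def mult.assoc)
    have "real (card A') \<le> real (card A) * real (4 * card \<Lambda> + 1) ^ K"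
      using A'(2) by (metis of_nat_le_iff of_nat_mult of_nat_power)
    also have "\<dots> \<le> exp (513 * X * L) * exp L ^ K"
      using cA L by (intro mult_mono power_mono) auto
    also have "\<dots> = exp (513 * X * L + real K * L)"
      by (simp add: exp_add exp_of_nat_mult)
    also have "\<dots> \<le> exp (1026 * X * L)"
      unfolding exp_le_cancel_iff using mult_right_mono[OF K(2) L_nonneg] by linarith
    finally show ?thesis using A'(1) by (auto simp: X_def mult.assoc)
  qed
qed

lemma entropy_bound:
  assumes "0 < t"
  shows "\<exists>A. covers t A \<and> real (card A) \<le> exp (1026 * real (card Q) * t powr (- q) * L)"
proof -
  obtain i where "real (card Q) / t < 2 ^ i"
    using real_arch_pow[of 2] by auto
  then have i: "real (card Q) \<le> 2 ^ i * t" using assms by (simp add: field_simps)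
  have "real (card Q) powr 1 \<le> real (card Q) powr q"
    using card_Q_pos q by (intro powr_mono) auto
  also have "\<dots> \<le> (2 ^ i * t) powr q" using i q by (intro powr_mono2) auto
  finally show ?thesis using entropy_bound_aux[OF assms] card_Q_pos by simp
qed

section \<open>Discretization by sampling the layers\<close>

text \<open>Nets at scale \<open>b i / 512\<close> leave finitely many functions per layer. The
  entropy bound and the Bernstein exponent both scale like \<open>b i powr (- q)\<close>, so a
  single \<open>m\<close> serves all layers.\<close>

lemma exists_discretization_unit:
  fixes l0 m :: nat
  assumes l0: "32 * real (card Q) \<le> 2 ^ l0" "real (4 * l0) \<le> exp L"
    and m: "0 < m" "3072 * (1026 * 2 ^ 18 + 1) * (card Q * L * (real l0)\<^sup>2) \<le> real m"
  shows "\<exists>\<xi>::nat \<Rightarrow> 'a. (\<forall>j\<in>{1..m}. \<xi> j \<in> \<Omega>) \<and>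
    (\<forall>c. mass c = 1 \<longrightarrow> (\<Sum>j=1..m. cmod (lincomb c (\<xi> j)) powr q) / m \<in> {1 / 2..3 / 2})"
proof -
  define N where "N = real (card Q)"
  have N: "1 \<le> N" using card_Q_pos by (simp add: N_def)
  have l0_pos: "0 < l0" using l0(1) N by (cases l0) (auto simp: N_def)
  \<comment> \<open>Starting at \<open>1 / 32\<close>, the part below all layers contributes at most
    \<open>(1 / 32) powr q \<le> 1 / 32\<close>.\<close>
  define b where "b = (\<lambda>i::nat. 2 ^ i * (1 / 32 :: real))"
  have b: "0 < b i" for i by (simp add: b_def)
  \<comment> \<open>The defining property and \<open>nikolskii\<close> keep functions of mass
    \<open>1\<close> below \<open>b l\<close>; minimality gives \<open>b i powr q \<le> N\<close>
    for \<open>i < l\<close>, hence \<open>1 \<le> X\<close> in the estimate of each layer.\<close>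
  define l where "l = (LEAST l. N \<le> b l powr q)"
  have "N powr 1 \<le> N powr q" using N q by (intro powr_mono) auto
  also have "\<dots> \<le> b l0 powr q" using l0(1) N q by (intro powr_mono2) (auto simp: b_def N_def)
  finally have l0': "N \<le> b l0 powr q" using N by simp
  have l: "N \<le> b l powr q" "l \<le> l0"
    unfolding l_def using l0' by (auto intro: LeastI Least_le)
  have bl: "b i powr q \<le> N" if "i < l" for i
    using not_less_Least[of i "\<lambda>l. N \<le> b l powr q"] that unfolding l_def by auto
  have "\<exists>A. covers (b i / 512) A \<and> real (card A) \<le> exp (1026 * real (card Q) * (b i / 512) powr (- q) * L)" for i
    using b by (intro entropy_bound) simp
  then obtain A where A: "\<And>i. covers (b i / 512) (A i)"
    "\<And>i. real (card (A i)) \<le> exp (1026 * N * (b i / 512) powr (- q) * L)"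
    unfolding N_def by metis
  have finA: "finite (A i)" and mA: "\<And>a. a \<in> A i \<Longrightarrow> mass a \<le> 1" for i
    using A(1)[of i] by (auto simp: covers_def)
  \<comment> \<open>At most \<open>l0\<close> layers, each sampled with this accuracy, give a total
    error of at most \<open>1 / 16\<close>.\<close>
  define \<eta> where "\<eta> = 1 / (16 * real l0)"
  define h where "h = (\<lambda>(i, c) x. layer q (b i) (cmod (lincomb c x)))"
  define I where "I = Sigma {..<l} A"
  define B where "B = (\<lambda>(i::nat, c::'k \<Rightarrow> complex). 3 * b i powr q)"
  have \<eta>: "0 < \<eta>" "\<eta> \<le> 1" using l0_pos by (auto simp: \<eta>_def)
  have h_meas: "h p \<in> borel_measurable M" for p
    unfolding h_def layer_def by (cases p) simp
  have h0: "0 \<le> h p x" and hB: "h p x \<le> B p" for p x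
    using layer_nonneg[OF q b] layer_le[OF q b] by (auto simp: h_def B_def split: prod.splits)
  have h_int: "integrable M (h p)" for p
    using h_meas h0 hB by (intro integrable_const_bound[where B="B p"]) auto
  have h_le: "expectation (h p) \<le> 1" if pI: "p \<in> I" for p
  proof -
    obtain i c where p: "p = (i, c)" "c \<in> A i" using pI by (auto simp: I_def)
    have "expectation (h p) \<le> mass c"
      unfolding mass_def using layer_le_powr[OF q b] p
      by (intro integral_mono h_int integrable_mass) (auto simp: h_def)
    then show ?thesis using mA[OF p(2)] by simp
  qed
  have small: "real (card (A i)) * exp (- (real m * \<eta>\<^sup>2 / (12 * b i powr q))) \<le> 1 / (4 * real l0)"
    if i: "i < l" for i
  proof -
    define X where "X = N * b i powr (- q)"
    have X: "1 \<le> X" using bl[OF i] b[of i] by (simp add: X_def powr_minus divide_simps)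
    \<comment> \<open>The factor \<open>2 ^ 18\<close> is the loss from evaluating the entropy at
      \<open>b i / 512\<close> instead of \<open>b i\<close>.\<close>
    have "512 powr q \<le> (512::real) powr 2" using q by (intro powr_mono) auto
    then have "(b i / 512) powr (- q) \<le> b i powr (- q) * 2 ^ 18"
      using b[of i] by (simp add: powr_divide powr_minus divide_simps)
    then have "N * L * (b i / 512) powr (- q) \<le> N * L * (b i powr (- q) * 2 ^ 18)"
      using N L_nonneg by (intro mult_left_mono) auto
    then have "1026 * N * (b i / 512) powr (- q) * L \<le> 1026 * 2 ^ 18 * X * L"
      by (simp add: X_def mult_ac)
    then have c: "real (card (A i)) \<le> exp (1026 * 2 ^ 18 * X * L)"
      using A(2)[of i] by (meson exp_le_cancel_iff order_trans)
    \<comment> \<open>Here \<open>3072 = 12 * 16\<^sup>2\<close>, with \<open>12 = 4 * 3\<close>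
      from \<open>4 * B p\<close> and \<open>16\<close> from \<open>\<eta>\<close>. The
      \<open>1\<close> added to the entropy constant leaves a factor \<open>exp (- L)\<close>, which
      pays for the number of layers.\<close>
    have "12 * (1026 * 2 ^ 18 + 1) * (N * L) = 3072 * (1026 * 2 ^ 18 + 1) * (N * L * (real l0)\<^sup>2) * \<eta>\<^sup>2"
      using l0_pos by (simp add: \<eta>_def power2_eq_square field_simps)
    also have "\<dots> \<le> real m * \<eta>\<^sup>2"
      using m(2) by (intro mult_right_mono) (auto simp: N_def)
    finally have "(12 * (1026 * 2 ^ 18 + 1) * (N * L)) / (12 * b i powr q) \<le> real m * \<eta>\<^sup>2 / (12 * b i powr q)"
      by (intro divide_right_mono) auto
    also have "(12 * (1026 * 2 ^ 18 + 1) * (N * L)) / (12 * b i powr q) = (1026 * 2 ^ 18 + 1) * X * L"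
      using b[of i] by (simp add: X_def powr_minus divide_simps)
    finally have "(1026 * 2 ^ 18 + 1) * X * L \<le> real m * \<eta>\<^sup>2 / (12 * b i powr q)" .
    moreover have "L \<le> X * L" using mult_right_mono[OF X L_nonneg] by simp
    ultimately have "1026 * 2 ^ 18 * X * L + - (real m * \<eta>\<^sup>2 / (12 * b i powr q)) \<le> - L"
      by (simp add: algebra_simps)
    have "real (card (A i)) * exp (- (real m * \<eta>\<^sup>2 / (12 * b i powr q)))
        \<le> exp (1026 * 2 ^ 18 * X * L) * exp (- (real m * \<eta>\<^sup>2 / (12 * b i powr q)))"
      using c by (intro mult_right_mono) auto
    also have "\<dots> \<le> exp (- L)"
      unfolding exp_add[symmetric] exp_le_cancel_iff by fact
    also have "\<dots> \<le> 1 / (4 * real l0)"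
      using l0(2) l0_pos by (simp add: exp_minus divide_simps)
    finally show ?thesis .
  qed
  have "(\<Sum>p\<in>I. 2 * exp (- (real m * \<eta>\<^sup>2 / (4 * B p)))) =
      (\<Sum>i<l. \<Sum>c\<in>A i. 2 * exp (- (real m * \<eta>\<^sup>2 / (4 * B (i, c)))))"
    unfolding I_def using finA by (simp add: sum.Sigma)
  also have "\<dots> = (\<Sum>i<l. 2 * (real (card (A i)) * exp (- (real m * \<eta>\<^sup>2 / (12 * b i powr q)))))"
    by (simp add: B_def mult.left_commute)
  also have "\<dots> \<le> (\<Sum>i<l. 2 * (1 / (4 * real l0)))"
    using small by (intro sum_mono mult_left_mono) auto
  also have "\<dots> < 1" using l(2) l0_pos by (simp add: divide_simps)
  finally have "(\<Sum>p\<in>I. 2 * exp (- (real m * \<eta>\<^sup>2 / (4 * B p)))) < 1" .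
  moreover have "finite I" using finA by (simp add: I_def)
  moreover have "0 < B p" for p using b by (cases p) (simp add: B_def less_imp_neq[symmetric])
  ultimately have "\<exists>\<xi>::nat \<Rightarrow> 'a. (\<forall>j\<in>{1..m}. \<xi> j \<in> \<Omega>) \<and>
      (\<forall>p\<in>I. \<bar>(\<Sum>j=1..m. h p (\<xi> j)) / real m - expectation (h p)\<bar> \<le> \<eta>)"
    using AE_\<Omega> h_meas h0 hB h_le \<eta> m(1) by (intro exists_sampling_points) assumption+
  then obtain \<xi> where \<xi>: "\<forall>j\<in>{1..m}. \<xi> j \<in> \<Omega>"
    and dev: "\<And>p. p \<in> I \<Longrightarrow> \<bar>(\<Sum>j=1..m. h p (\<xi> j)) / real m - expectation (h p)\<bar> \<le> \<eta>"
    by blast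
  have "(\<Sum>j=1..m. cmod (lincomb c (\<xi> j)) powr q) / m \<in> {1 / 2..3 / 2}" if c: "mass c = 1" for c
  proof -
    have "\<exists>a\<in>A i. \<forall>x\<in>\<Omega>. cmod (lincomb c x - lincomb a x) \<le> b i / 512" for i
      using A(1)[of i] c by (auto simp: covers_def)
    then obtain a where a: "\<And>i. a i \<in> A i"
      "\<And>i x. x \<in> \<Omega> \<Longrightarrow> cmod (lincomb c x - lincomb (a i) x) \<le> b i / 512"
      by metis
    define S where "S = (\<lambda>x. \<Sum>i<l. h (i, a i) x)"
    let ?v = "\<lambda>x. cmod (lincomb c x) powr q"
    have approx: "\<bar>?v x - S x\<bar> \<le> 1 / 16 * ?v x + 1 / 32" if x: "x \<in> \<Omega>" for x
    proof -
      have "cmod (lincomb c x) \<le> b l"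
      proof (rule ccontr)
        assume "\<not> cmod (lincomb c x) \<le> b l"
        then have "b l powr q < ?v x" using q b[of l] by (intro powr_less_mono2) auto
        then show False using nikolskii[of c x] c x l(1) by (simp add: N_def)
      qed
      moreover have "\<bar>cmod (lincomb c x) - cmod (lincomb (a i) x)\<bar> \<le> 1 / 512 * b i" for i
        using a(2)[OF x, of i] norm_triangle_ineq3[of "lincomb c x" "lincomb (a i) x"] by simp
      ultimately have "\<bar>?v x - (\<Sum>i<l. layer q (b i) (cmod (lincomb (a i) x)))\<bar>
          \<le> 32 * (1 / 512) * ?v x + (1 / 32) powr q"
        unfolding b_def by (intro layer_decomposition[OF q]) auto
      moreover have "(1 / 32) powr q \<le> (1 / 32 :: real)"
        using powr_mono'[of 1 q "1 / 32 :: real"] q by simp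
      ultimately show ?thesis by (simp add: S_def h_def)
    qed
    define P where "P = (\<Sum>j=1..m. ?v (\<xi> j)) / m"
    define PS where "PS = (\<Sum>j=1..m. S (\<xi> j)) / m"
    have "\<bar>P - PS\<bar> \<le> 1 / 16 * P + 1 / 32"
    proof -
      have "\<bar>(\<Sum>j=1..m. ?v (\<xi> j)) - (\<Sum>j=1..m. S (\<xi> j))\<bar> \<le> (\<Sum>j=1..m. 1 / 16 * ?v (\<xi> j) + 1 / 32)"
        unfolding sum_subtractf[symmetric]
        by (rule order_trans[OF sum_abs]) (use approx \<xi> in \<open>intro sum_mono, auto\<close>)
      then have "\<bar>(\<Sum>j=1..m. ?v (\<xi> j)) - (\<Sum>j=1..m. S (\<xi> j))\<bar> / m \<le> (1 / 16 * (\<Sum>j=1..m. ?v (\<xi> j)) + m / 32) / m"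
        by (intro divide_right_mono) (auto simp: sum.distrib sum_distrib_left sum_divide_distrib)
      then show ?thesis
        using m(1) by (simp add: P_def PS_def diff_divide_distrib[symmetric] add_divide_distrib)
    qed
    moreover have "\<bar>1 - expectation S\<bar> \<le> 1 / 16 + 1 / 32"
    proof -
      have int: "integrable M S" using h_int by (simp add: S_def[abs_def])
      have "\<bar>expectation (\<lambda>x. ?v x - S x)\<bar> \<le> expectation (\<lambda>x. 1 / 16 * ?v x + 1 / 32)"
        by (rule order_trans[OF integral_abs_bound integral_mono_AE])
           (use int integrable_mass approx AE_\<Omega> in \<open>auto elim: AE_mp\<close>)
      also have "\<dots> = 1 / 16 + 1 / 32"
        using integrable_mass[of c] c by (simp add: mass_def prob_space)
      also have "expectation (\<lambda>x. ?v x - S x) = 1 - expectation S"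
        using integrable_mass[of c] int c by (simp add: mass_def)
      finally show ?thesis .
    qed
    moreover have "\<bar>PS - expectation S\<bar> \<le> 1 / 16"
    proof -
      have "PS = (\<Sum>i<l. (\<Sum>j=1..m. h (i, a i) (\<xi> j)) / m)"
        unfolding PS_def S_def sum_divide_distrib[symmetric] by (subst sum.swap) simp
      moreover have "expectation S = (\<Sum>i<l. expectation (h (i, a i)))"
        unfolding S_def using h_int by simp
      ultimately have "\<bar>PS - expectation S\<bar> \<le> (\<Sum>i<l. \<bar>(\<Sum>j=1..m. h (i, a i) (\<xi> j)) / m - expectation (h (i, a i))\<bar>)"
        by (simp add: sum_subtractf[symmetric])
      also have "\<dots> \<le> (\<Sum>i<l. \<eta>)"
        using dev a(1) by (intro sum_mono) (auto simp: I_def)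
      also have "\<dots> \<le> 1 / 16" using l(2) l0_pos by (simp add: \<eta>_def divide_simps)
      finally show ?thesis .
    qed
    \<comment> \<open>\<open>PS\<close> lies between \<open>27 / 32\<close> and
      \<open>37 / 32\<close>; the error \<open>P / 16\<close> is then absorbed on the side of
      \<open>P\<close>.\<close>
    ultimately have "1 / 2 \<le> P" "P \<le> 3 / 2" unfolding abs_le_iff by linarith+
    then show ?thesis by (simp add: P_def)
  qed
  with \<xi> show ?thesis by blast
qed

lemma mass_scale: "0 \<le> r \<Longrightarrow> mass (\<lambda>k. complex_of_real r * c k) = r powr q * mass c"
  by (simp add: mass_def lincomb_scale norm_mult powr_mult)

text \<open>Vanishing mass forces vanishing energy, and the energy controls the value at every
  point, not only almost everywhere.\<close>

lemma lincomb_eq_0_if_mass_eq_0: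
  assumes "mass c = 0"
  shows "lincomb c x = 0"
proof -
  \<comment> \<open>The added \<open>1\<close> makes the uniform bound positive, as
    \<open>energy_le_mass\<close> requires.\<close>
  have "cmod (lincomb c y) \<le> (\<Sum>k\<in>Q. cmod (c k)) + 1" for y
    using cmod_lincomb_le_sum[of c y] by simp
  then have "energy c \<le> ((\<Sum>k\<in>Q. cmod (c k)) + 1) powr (2 - q) * mass c"
    by (intro energy_le_mass) (simp_all add: add_nonneg_pos sum_nonneg)
  then have "(cmod (lincomb c x))\<^sup>2 \<le> 0"
    using assms energy_nonneg[of c] cmod_lincomb_sq_le[of c x] by simp
  then show ?thesis by simp
qed

text \<open>Both sides are homogeneous of degree \<open>q\<close>, so scaling reduces to mass
  \<open>1\<close>; if the mass is \<open>0\<close>, the function vanishes at all sampling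
  points.\<close>

theorem exists_discretization:
  fixes l0 m :: nat
  assumes "32 * real (card Q) \<le> 2 ^ l0" "real (4 * l0) \<le> exp L"
    and "0 < m" "3072 * (1026 * 2 ^ 18 + 1) * (card Q * L * (real l0)\<^sup>2) \<le> real m"
  shows "\<exists>\<xi>::nat \<Rightarrow> 'a. (\<forall>j\<in>{1..m}. \<xi> j \<in> \<Omega>) \<and>
    (\<forall>c. (\<Sum>j=1..m. cmod (lincomb c (\<xi> j)) powr q) / m \<in> {1 / 2 * mass c..3 / 2 * mass c})"
proof -
  obtain \<xi> where \<xi>: "\<forall>j\<in>{1..m}. \<xi> j \<in> \<Omega>"
    "\<And>c. mass c = 1 \<Longrightarrow> (\<Sum>j=1..m. cmod (lincomb c (\<xi> j)) powr q) / m \<in> {1 / 2..3 / 2}"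
    using exists_discretization_unit[OF assms] by blast
  have "(\<Sum>j=1..m. cmod (lincomb c (\<xi> j)) powr q) / m \<in> {1 / 2 * mass c..3 / 2 * mass c}" for c
  proof (cases "mass c = 0")
    case True
    then show ?thesis by (simp add: lincomb_eq_0_if_mass_eq_0)
  next
    case False
    then have pos: "0 < mass c" using mass_nonneg[of c] by simp
    define r where "r = mass c powr (- 1 / q)"
    have "r powr q = mass c powr - 1"
      unfolding r_def powr_powr using q by simp
    then have r: "0 < r" "r powr q = 1 / mass c"
      using pos by (auto simp: r_def powr_minus_divide)
    have "(\<Sum>j=1..m. cmod (lincomb (\<lambda>k. complex_of_real r * c k) (\<xi> j)) powr q) / m \<in> {1 / 2..3 / 2}"
      using r pos by (intro \<xi>(2)) (simp add: mass_scale)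
    moreover have "(\<Sum>j=1..m. cmod (lincomb (\<lambda>k. complex_of_real r * c k) (\<xi> j)) powr q)
        = (\<Sum>j=1..m. cmod (lincomb c (\<xi> j)) powr q) / mass c"
      using r by (simp add: lincomb_scale norm_mult powr_mult sum_divide_distrib)
    ultimately have "((\<Sum>j=1..m. cmod (lincomb c (\<xi> j)) powr q) / m) / mass c \<in> {1 / 2..3 / 2}"
      by (simp add: mult.commute)
    then show ?thesis
      using pos by (simp add: pos_le_divide_eq pos_divide_le_eq del: divide_divide_eq_left)
  qed
  with \<xi>(1) show ?thesis by blast
qed

end

section \<open>Characters of the torus\<close>

text \<open>Fubini for products of one-variable functions: \<open>lborel\<close> is the image of a
  product of one-dimensional Lebesgue measures.\<close>

lemma integral_lborel_prod:
  fixes f :: "'b::euclidean_space \<Rightarrow> real \<Rightarrow> complex"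
  assumes f: "\<And>b. b \<in> Basis \<Longrightarrow> integrable lborel (f b)"
  shows "(\<integral>x. (\<Prod>b\<in>Basis. f b (x \<bullet> b)) \<partial>lborel) = (\<Prod>b\<in>Basis. \<integral>t. f b t \<partial>lborel)"
proof -
  interpret product_sigma_finite "\<lambda>_::'b. lborel :: real measure"
    by standard
  have [measurable]: "f b \<in> borel_measurable borel" if "b \<in> Basis" for b
    using borel_measurable_integrable[OF f[OF that]] by simp
  have "(\<integral>x. (\<Prod>b\<in>Basis. f b (x \<bullet> b)) \<partial>lborel)
      = (\<integral>y. (\<Prod>b\<in>Basis. f b ((\<Sum>a\<in>Basis. y a *\<^sub>R a) \<bullet> b)) \<partial>(\<Pi>\<^sub>M b\<in>Basis. lborel))"
    by (subst lborel_eq) (simp add: integral_distr)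
  also have "\<dots> = (\<integral>y. (\<Prod>b\<in>Basis. f b (y b)) \<partial>(\<Pi>\<^sub>M b\<in>Basis. lborel))"
    by (simp add: inner_sum_left inner_Basis if_distrib cong: if_cong)
  also have "\<dots> = (\<Prod>b\<in>Basis. \<integral>t. f b t \<partial>lborel)"
    by (rule product_integral_prod) (auto intro: f)
  finally show ?thesis .
qed

lemma prod_Basis_vec:
  fixes F :: "real ^ 'd \<Rightarrow> 'c::comm_monoid_mult"
  shows "(\<Prod>b\<in>Basis. F b) = (\<Prod>j\<in>UNIV. F (axis j 1))"
proof -
  have B: "(Basis :: (real ^ 'd) set) = (\<lambda>j. axis j 1) ` UNIV" by (auto simp: Basis_vec_def)
  have inj: "inj (\<lambda>j::'d. axis j (1::real))" by (auto simp: inj_on_def axis_eq_axis)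
  show ?thesis unfolding B by (subst prod.reindex[OF inj]) (rule prod.cong, auto)
qed

lemma integral_lborel_prod_vec:
  fixes f :: "'d::finite \<Rightarrow> real \<Rightarrow> complex"
  assumes f: "\<And>j. integrable lborel (f j)"
  shows "(\<integral>x. (\<Prod>j\<in>UNIV. f j (x $ j)) \<partial>lborel) = (\<Prod>j\<in>UNIV. \<integral>t. f j t \<partial>lborel)"
proof -
  \<comment> \<open>The product over \<open>Basis\<close> is indexed by vectors, so the coordinate
    index is recovered from its axis vector.\<close>
  define h :: "real ^ 'd \<Rightarrow> real \<Rightarrow> complex" where "h = (\<lambda>b. f (THE j. b = axis j 1))"
  have h: "h (axis j 1) = f j" for j
    by (simp add: h_def axis_eq_axis)
  have "(\<integral>x. (\<Prod>b\<in>Basis. h b (x \<bullet> b)) \<partial>lborel) = (\<Prod>b\<in>Basis. \<integral>t. h b t \<partial>lborel)"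
    using f h by (intro integral_lborel_prod) (auto simp: Basis_vec_def)
  then show ?thesis by (simp add: prod_Basis_vec h inner_axis)
qed

lemma integral_cis_period:
  fixes n :: int
  assumes n: "n \<noteq> 0"
  shows "(\<integral>t. indicator {0..<2 * pi} t *\<^sub>R cis (of_int n * t) \<partial>lborel) = 0"
proof -
  define F where "F = (\<lambda>z. exp (\<i> * of_int n * z) / (\<i> * of_int n))"
  have [measurable]: "(\<lambda>t. cis (of_int n * t)) \<in> borel_measurable borel"
    by (intro borel_measurable_continuous_onI continuous_intros)
  have "(\<integral>t. indicator {0..<2 * pi} t *\<^sub>R cis (of_int n * t) \<partial>lborel)
      = (\<integral>t. indicator {0..2 * pi} t *\<^sub>R cis (of_int n * t) \<partial>lborel)"
  \<comment> \<open>The fundamental theorem of calculus is applied on the closed interval; the added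
    endpoint is a null set.\<close>
  proof (rule integral_cong_AE)
    show "AE t in lborel. indicator {0..<2 * pi} t *\<^sub>R cis (of_int n * t) = indicator {0..2 * pi} t *\<^sub>R cis (of_int n * t)"
      using AE_lborel_singleton[of "2 * pi"] by eventually_elim (auto simp: indicator_def)
  qed auto
  also have "\<dots> = F (of_real (2 * pi)) - F (of_real 0)"
  proof (rule integral_FTC_Icc)
    fix t :: real
    have "(F has_field_derivative exp (\<i> * of_int n * of_real t)) (at (of_real t))"
      unfolding F_def using n by (auto intro!: derivative_eq_intros)
    then have "((\<lambda>t. F (of_real t)) has_vector_derivative exp (\<i> * of_int n * of_real t)) (at t within {0..2 * pi})"
      by (rule has_vector_derivative_real_field)
    then show "((\<lambda>t. F (of_real t)) has_vector_derivative cis (of_int n * t)) (at t within {0..2 * pi})"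
      by (simp add: cis_conv_exp mult.assoc)
  qed (auto intro!: continuous_intros)
  also have "\<dots> = 0"
  proof -
    have "exp (\<i> * of_int n * of_real (2 * pi)) = (1::complex)"
      using exp_integer_2pi[of "of_int n"] by (simp add: mult_ac)
    then show ?thesis by (simp add: F_def)
  qed
  finally show ?thesis .
qed

lemma torus_measurable [measurable]: "torus \<in> sets borel"
  unfolding torus_def by measurable

lemma integral_torus_measure:
  fixes f :: "real ^ 'd \<Rightarrow> complex"
  assumes [measurable]: "f \<in> borel_measurable borel"
  shows "integral\<^sup>L torus_measure f = (\<integral>x. indicator torus x *\<^sub>R f x \<partial>lborel) /\<^sub>R measure lborel (torus :: (real ^ 'd) set)"
proof -
  interpret prob_space "torus_measure :: (real ^ 'd) measure"
    by (rule prob_space_torus_measure)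
  let ?T = "torus :: (real ^ 'd) set"
  define V where "V = measure lborel ?T"
  have "emeasure torus_measure (space torus_measure :: (real ^ 'd) set) = emeasure lborel ?T / emeasure lborel ?T"
    unfolding torus_measure_def by (subst emeasure_uniform_measure) auto
  then have "emeasure lborel ?T / emeasure lborel ?T = 1" by (simp add: emeasure_space_1)
  \<comment> \<open>In \<open>ennreal\<close> both \<open>0 / 0\<close> and
    \<open>\<infinity> / \<infinity>\<close> are \<open>0\<close>, so a quotient of \<open>1\<close>
    excludes these two cases.\<close>
  then have "emeasure lborel ?T \<noteq> \<infinity>" "emeasure lborel ?T \<noteq> 0" by (auto simp: ennreal_top_divide)
  then have V: "emeasure lborel ?T = ennreal V" "0 < V"
    unfolding V_def by (auto simp: emeasure_eq_ennreal_measure zero_less_measure_iff)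
  have "torus_measure = density lborel (\<lambda>x. ennreal (indicator ?T x / V))"
    unfolding torus_measure_def uniform_measure_def V(1)
  proof (intro arg_cong[where f="density lborel"] ext)
    fix x :: "real ^ 'd"
    show "indicator ?T x / ennreal V = ennreal (indicator ?T x / V)"
      using divide_ennreal[of 1 V] V(2) by (simp add: indicator_def)
  qed
  moreover have "integral\<^sup>L (density lborel (\<lambda>x. ennreal (indicator ?T x / V))) f
      = (\<integral>x. (indicator ?T x / V) *\<^sub>R f x \<partial>lborel)"
    using V(2) by (intro integral_density) auto
  ultimately have "integral\<^sup>L torus_measure f = (\<integral>x. (indicator ?T x / V) *\<^sub>R f x \<partial>lborel)"
    by simp
  also have "(\<lambda>x. (indicator ?T x / V) *\<^sub>R f x) = (\<lambda>x. inverse V *\<^sub>R (indicator ?T x *\<^sub>R f x))"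
    by (simp add: divide_inverse mult.commute)
  finally show ?thesis by (simp only: integral_scaleR_right V_def)
qed

text \<open>The integral factors over the coordinates, and a coordinate with nonzero frequency
  contributes the factor \<open>0\<close>.\<close>

lemma integral_torus_cis:
  fixes n :: "int ^ 'd"
  assumes "n \<noteq> 0"
  shows "(\<integral>x. cis (\<Sum>j\<in>UNIV. of_int (n $ j) * x $ j) \<partial>torus_measure) = 0"
proof -
  let ?f = "\<lambda>j t. indicator {0..<2 * pi} t *\<^sub>R cis (of_int (n $ j) * t)"
  obtain j where j: "n $ j \<noteq> 0" using assms by (auto simp: vec_eq_iff)
  have int: "integrable lborel (?f i)" for i
    by (rule integrableI_bounded_set_indicator[where B=1])
       (auto intro!: borel_measurable_continuous_onI continuous_intros)
  have "indicator torus x *\<^sub>R cis (\<Sum>j\<in>UNIV. of_int (n $ j) * x $ j) = (\<Prod>j\<in>UNIV. ?f j (x $ j))" for x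
  proof (cases "x \<in> torus")
    case True
    then show ?thesis
      by (simp add: torus_def cis_conv_exp exp_sum[symmetric] sum_distrib_left)
  next
    case False
    then obtain i where "x $ i \<notin> {0..<2 * pi}" by (auto simp: torus_def)
    then have "(\<Prod>j\<in>UNIV. ?f j (x $ j)) = 0" by (intro prod_zero bexI[of _ i]) auto
    then show ?thesis using False by simp
  qed
  then have "(\<integral>x. indicator torus x *\<^sub>R cis (\<Sum>j\<in>UNIV. of_int (n $ j) * x $ j) \<partial>lborel)
      = (\<Prod>j\<in>UNIV. \<integral>t. ?f j t \<partial>lborel)"
    using integral_lborel_prod_vec[of ?f] int by simp
  also have "\<dots> = 0" using integral_cis_period[OF j] by (intro prod_zero bexI[of _ j]) auto
  finally show ?thesis by (subst integral_torus_measure) (auto intro!: borel_measurable_continuous_onI continuous_intros)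
qed

definition character :: "int ^ 'd \<Rightarrow> real ^ 'd \<Rightarrow> complex" where
  "character k x = cis (\<Sum>j\<in>UNIV. of_int (k $ j) * x $ j)"

lemma character_measurable [measurable]: "character k \<in> borel_measurable borel"
  unfolding character_def[abs_def] by (intro borel_measurable_continuous_onI continuous_intros)

lemma AE_torus: "AE x in torus_measure. x \<in> (torus :: (real ^ 'd) set)"
  unfolding torus_measure_def by (rule AE_uniform_measureI) auto

lemma character_orthonormal:
  "(\<integral>x. character k x * cnj (character l x) \<partial>torus_measure) = of_bool (k = l)"
proof -
  interpret prob_space "torus_measure :: (real ^ 'd) measure"
    by (rule prob_space_torus_measure)
  have "character k x * cnj (character l x) = cis (\<Sum>j\<in>UNIV. of_int ((k - l) $ j) * x $ j)" for x
    by (simp add: character_def cis_cnj cis_mult sum_subtractf algebra_simps)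
  then show ?thesis
    using integral_torus_cis[of "k - l"] by (auto simp: prob_space)
qed

lemma character_diff_le: "cmod (character k x - character k y) \<le> (\<Sum>j\<in>UNIV. \<bar>of_int (k $ j)\<bar> * \<bar>x $ j - y $ j\<bar>)"
proof -
  let ?a = "\<lambda>x. \<Sum>j\<in>UNIV. of_int (k $ j) * x $ j"
  have "character k x - character k y = cis (?a y) * (cis (?a x - ?a y) - 1)"
    by (simp add: character_def cis_mult algebra_simps)
  then have "cmod (character k x - character k y) = 2 * \<bar>sin ((?a x - ?a y) / 2)\<bar>"
    using dist_exp_i_1[of "?a x - ?a y"] by (simp add: norm_mult cis_conv_exp)
  also have "\<dots> \<le> \<bar>?a x - ?a y\<bar>"
    using abs_sin_x_le_abs_x[of "(?a x - ?a y) / 2"] by simp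
  also have "?a x - ?a y = (\<Sum>j\<in>UNIV. of_int (k $ j) * (x $ j - y $ j))"
    by (simp add: sum_subtractf[symmetric] algebra_simps)
  also have "\<bar>\<dots>\<bar> \<le> (\<Sum>j\<in>UNIV. \<bar>of_int (k $ j) * (x $ j - y $ j)\<bar>)" by (rule sum_abs)
  finally show ?thesis by (simp add: abs_mult)
qed

section \<open>Grids on the torus and the size of the hyperbolic cross\<close>

definition torus_grid :: "nat \<Rightarrow> (real ^ 'd) set" where
  "torus_grid g = (\<lambda>h. \<chi> j. 2 * pi * real (h j) / real g) ` (UNIV \<rightarrow>\<^sub>E {..<g})"

lemma finite_torus_grid: "finite (torus_grid g :: (real ^ 'd) set)"
  unfolding torus_grid_def by (intro finite_imageI finite_PiE) auto

lemma card_torus_grid_le: "card (torus_grid g :: (real ^ 'd) set) \<le> g ^ CARD('d)"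
proof -
  have "card (torus_grid g :: (real ^ 'd) set) \<le> card ((UNIV :: 'd set) \<rightarrow>\<^sub>E {..<g})"
    unfolding torus_grid_def by (intro card_image_le finite_PiE) auto
  then show ?thesis by (simp add: card_PiE)
qed

lemma torus_grid_dense:
  assumes x: "x \<in> torus" and g: "0 < g"
  shows "\<exists>y\<in>torus_grid g. \<forall>j. \<bar>x $ j - y $ j\<bar> \<le> 2 * pi / g"
proof -
  define h where "h = (\<lambda>j. nat \<lfloor>x $ j * g / (2 * pi)\<rfloor>)"
  have h: "real (h j) \<le> x $ j * g / (2 * pi)" "x $ j * g / (2 * pi) < real (h j) + 1" for j
  proof -
    have "0 \<le> x $ j * g / (2 * pi)" using x by (simp add: torus_def)
    then show "real (h j) \<le> x $ j * g / (2 * pi)" "x $ j * g / (2 * pi) < real (h j) + 1"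
      unfolding h_def by linarith+
  qed
  \<comment> \<open>The cube is half-open, so \<open>x $ j < 2 * pi\<close> and the index
    \<open>g\<close> does not occur.\<close>
  have hg: "h j < g" for j
  proof -
    have "x $ j * g < 2 * pi * g" using x g by (simp add: torus_def)
    then have "x $ j * g / (2 * pi) < g" by (simp add: divide_less_eq mult.commute)
    then show ?thesis using h(1)[of j] by simp
  qed
  have "\<bar>x $ j - 2 * pi * real (h j) / g\<bar> \<le> 2 * pi / g" for j
  proof -
    have "x $ j - 2 * pi * real (h j) / g = (x $ j * g / (2 * pi) - real (h j)) * (2 * pi / g)"
      using g by (simp add: field_simps)
    also have "\<bar>\<dots>\<bar> \<le> 1 * (2 * pi / g)"
      unfolding abs_mult using h[of j] by (intro mult_mono) auto
    finally show ?thesis by simp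
  qed
  then show ?thesis
    using hg by (intro bexI[of _ "\<chi> j. 2 * pi * real (h j) / g"]) (auto simp: torus_grid_def)
qed

lemma abs_step_hyperbolic_cross:
  assumes "k \<in> step_hyperbolic_cross n"
  shows "\<bar>k $ j\<bar> < 2 ^ n"
proof -
  obtain s :: "nat ^ 'a" where s: "(\<Sum>j\<in>UNIV. s $ j) \<le> n" "\<bar>k $ j\<bar> < 2 ^ (s $ j)"
    using assms by (auto simp: step_hyperbolic_cross_def dyadic_block_def)
  have "s $ j \<le> (\<Sum>j\<in>UNIV. s $ j)" by (rule member_le_sum) auto
  then have "(2::int) ^ (s $ j) \<le> 2 ^ n" using s(1) by (intro power_increasing) auto
  then show ?thesis using s(2) by linarith
qed

lemma zero_in_step_hyperbolic_cross: "0 \<in> step_hyperbolic_cross n"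
proof -
  have "0 \<in> dyadic_block 0"
    by (simp add: dyadic_block_def power_int_def)
  then show ?thesis by (auto simp: step_hyperbolic_cross_def intro!: exI[of _ 0])
qed

text \<open>Counting the lattice points of an enclosing cube is crude, but this bound only enters
  through its logarithm, in the grid exponent and the number of layers.\<close>

lemma card_step_hyperbolic_cross_le:
  "card (step_hyperbolic_cross n :: (int ^ 'd) set) \<le> 2 ^ ((n + 2) * CARD('d))"
proof -
  let ?B = "UNIV \<rightarrow>\<^sub>E {- (2 ^ n) .. 2 ^ n :: int} :: ('d \<Rightarrow> int) set"
  have "vec_nth ` (step_hyperbolic_cross n :: (int ^ 'd) set) \<subseteq> ?B"
  proof safe
    fix k :: "int ^ 'd" and j :: 'd
    assume "k \<in> step_hyperbolic_cross n"
    then show "k $ j \<in> {- (2 ^ n) .. 2 ^ n}" using abs_step_hyperbolic_cross[of k n j] unfolding atLeastAtMost_iff by linarith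
  qed simp
  moreover have "finite ?B" by (intro finite_PiE) auto
  ultimately have "card (vec_nth ` (step_hyperbolic_cross n :: (int ^ 'd) set)) \<le> card ?B"
    by (rule card_mono[rotated])
  moreover have "card (vec_nth ` (step_hyperbolic_cross n :: (int ^ 'd) set)) = card (step_hyperbolic_cross n :: (int ^ 'd) set)"
    by (rule card_image) (auto simp: inj_on_def vec_eq_iff)
  moreover have "card ?B = nat (2 * 2 ^ n + 1) ^ CARD('d)" by (simp add: card_PiE)
  moreover have "nat (2 * 2 ^ n + 1) ^ CARD('d) \<le> (2 ^ (n + 2)) ^ CARD('d)"
  proof (rule power_mono)
    have "(1::int) \<le> 2 ^ n" "(2::int) ^ (n + 2) = 4 * 2 ^ n" by (simp_all add: power_add)
    then have "2 * 2 ^ n + 1 \<le> (2::int) ^ (n + 2)" by linarith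
    then show "nat (2 * 2 ^ n + 1) \<le> 2 ^ (n + 2)" by (simp only: nat_le_iff of_nat_power of_nat_numeral)
  qed simp
  ultimately show ?thesis by (simp only: power_mult)
qed

lemma real_card_step_hyperbolic_cross:
  "1 \<le> real (card (step_hyperbolic_cross n :: (int ^ 'd) set))"
  "real (card (step_hyperbolic_cross n :: (int ^ 'd) set)) \<le> 2 ^ ((n + 2) * CARD('d))"
proof -
  have "0 < card (step_hyperbolic_cross n :: (int ^ 'd) set)"
    using finite_step_hyperbolic_cross zero_in_step_hyperbolic_cross card_gt_0_iff by blast
  then show "1 \<le> real (card (step_hyperbolic_cross n :: (int ^ 'd) set))" by simp
  have "real (card (step_hyperbolic_cross n :: (int ^ 'd) set)) \<le> real (2 ^ ((n + 2) * CARD('d)))"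
    using card_step_hyperbolic_cross_le by (rule of_nat_mono)
  then show "real (card (step_hyperbolic_cross n :: (int ^ 'd) set)) \<le> 2 ^ ((n + 2) * CARD('d))" by simp
qed

lemma two_power_le_exp: "2 ^ k \<le> exp (real k)"
proof -
  have "(2::real) ^ k \<le> exp 1 ^ k" using exp_ge_add_one_self[of 1] by (intro power_mono) auto
  then show ?thesis by (simp add: exp_of_nat_mult[symmetric])
qed

lemma bounded_orthonormal_characters:
  fixes n :: nat
  defines "Q \<equiv> step_hyperbolic_cross n :: (int ^ 'd) set"
  shows "bounded_orthonormal_system torus_measure character Q torus"
proof -
  interpret prob_space "torus_measure :: (real ^ 'd) measure"
    by (rule prob_space_torus_measure)
  show ?thesis
  proof
    show "finite Q" "Q \<noteq> {}"
      unfolding Q_def using finite_step_hyperbolic_cross zero_in_step_hyperbolic_cross[of n] by auto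
    show "character k \<in> borel_measurable torus_measure" for k :: "int ^ 'd"
      using character_measurable[of k] unfolding torus_measure_def by simp
    show "cmod (character k x) \<le> 1" for k :: "int ^ 'd" and x by (simp add: character_def)
  qed (simp_all add: character_orthonormal AE_torus)
qed

text \<open>Frequencies are below \<open>2 ^ n\<close>, so a grid with exponent linear in
  \<open>n\<close> is fine enough for \<open>norming_if_dense\<close>, while the logarithm of its
  cardinality is still linear in \<open>n\<close>.\<close>

lemma character_sampled:
  fixes n :: nat
  defines "Q \<equiv> step_hyperbolic_cross n :: (int ^ 'd) set" and "d \<equiv> CARD('d)"
  assumes q: "1 \<le> q" "q \<le> 2" and g: "(n + 2) * d + n + d + 4 \<le> g" and L: "real (g * d + 3) \<le> L"
  shows "sampled_orthonormal_system torus_measure character Q torus q (torus_grid (2 ^ g)) L"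
proof -
  interpret bounded_orthonormal_system "torus_measure :: (real ^ 'd) measure" character Q torus
    unfolding Q_def by (rule bounded_orthonormal_characters)
  define N where "N = real (card Q)"
  have N: "1 \<le> N" "N \<le> 2 ^ ((n + 2) * d)"
    using real_card_step_hyperbolic_cross[where 'd='d, of n] unfolding N_def Q_def d_def .
  have dense: "\<exists>y\<in>torus_grid (2 ^ g). cmod (lincomb c x - lincomb c y) \<le> 1 / 2 * sqrt (energy c)"
    if x: "x \<in> torus" for c x
  proof -
    define \<delta> where "\<delta> = 2 * pi / 2 ^ g"
    obtain y where y: "y \<in> torus_grid (2 ^ g)" "\<And>j. \<bar>x $ j - y $ j\<bar> \<le> \<delta>"
      using torus_grid_dense[OF x, of "2 ^ g"] by (auto simp: \<delta>_def)
    have ch: "cmod (character k x - character k y) \<le> real d * 2 ^ n * \<delta>" if k: "k \<in> Q" for k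
    proof -
      have "\<bar>real_of_int (k $ j)\<bar> \<le> 2 ^ n" for j
        using abs_step_hyperbolic_cross[of k n j] k unfolding Q_def
        by (metis less_imp_le of_int_abs of_int_le_numeral_power_cancel_iff)
      then have "(\<Sum>j\<in>UNIV. \<bar>of_int (k $ j)\<bar> * \<bar>x $ j - y $ j\<bar>) \<le> (\<Sum>j\<in>(UNIV::'d set). 2 ^ n * \<delta>)"
        using y(2) by (intro sum_mono mult_mono) auto
      then show ?thesis using character_diff_le[of k x y] by (simp add: d_def)
    qed
    have "cmod (lincomb c x - lincomb c y) = cmod (\<Sum>k\<in>Q. c k * (character k x - character k y))"
      by (simp add: lincomb_def sum_subtractf algebra_simps)
    also have "\<dots> \<le> (\<Sum>k\<in>Q. cmod (c k) * (real d * 2 ^ n * \<delta>))"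
      by (rule order_trans[OF norm_sum]) (auto simp: norm_mult ch intro!: sum_mono mult_left_mono)
    also have "\<dots> = (real d * 2 ^ n * \<delta>) * (\<Sum>k\<in>Q. cmod (c k))"
      by (simp add: sum_distrib_right[symmetric] mult.commute)
    also have "\<dots> \<le> (real d * 2 ^ n * \<delta>) * (N * sqrt (energy c))"
    proof (rule mult_left_mono)
      have "(\<Sum>k\<in>Q. cmod (c k)) \<le> sqrt (N * energy c)"
        using sum_cmod_le[of c] by (simp add: real_le_rsqrt N_def)
      also have "\<dots> = sqrt N * sqrt (energy c)" by (simp add: real_sqrt_mult)
      also have "\<dots> \<le> N * sqrt (energy c)"
        using N(1) energy_nonneg[of c] by (intro mult_right_mono) (auto simp: real_le_lsqrt power2_eq_square)
      finally show "(\<Sum>k\<in>Q. cmod (c k)) \<le> N * sqrt (energy c)" .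
    qed (simp add: \<delta>_def)
    also have "\<dots> = (real d * 2 ^ n * \<delta> * N) * sqrt (energy c)" by simp
    also have "\<dots> \<le> 1 / 2 * sqrt (energy c)"
    proof (rule mult_right_mono)
      \<comment> \<open>The summands in the lower bound on \<open>g\<close> pay for
        \<open>N\<close>, the frequencies, the dimension through \<open>d \<le> 2 ^ d\<close>, and
        \<open>4 * pi \<le> 2 ^ 4\<close>.\<close>
      have "real d * 2 ^ n * N * (4 * pi) \<le> 2 ^ d * 2 ^ n * 2 ^ ((n + 2) * d) * 2 ^ 4"
        using N pi_less_4 by (intro mult_mono) (auto intro: less_imp_le)
      also have "\<dots> = 2 ^ ((n + 2) * d + n + d + 4)" by (simp only: power_add mult_ac)
      also have "\<dots> \<le> (2::real) ^ g" using g by (intro power_increasing) auto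
      finally show "real d * 2 ^ n * \<delta> * N \<le> 1 / 2" by (simp add: \<delta>_def field_simps)
    qed (simp add: energy_nonneg)
    finally show ?thesis using y(1) by blast
  qed
  show ?thesis
  proof
    show "1 \<le> q" "q \<le> 2" by fact+
    show "finite (torus_grid (2 ^ g) :: (real ^ 'd) set)" by (rule finite_torus_grid)
    show "cmod (lincomb c x) \<le> 2 * t"
      if "\<And>y. y \<in> torus_grid (2 ^ g) \<Longrightarrow> cmod (lincomb c y) \<le> t" "x \<in> torus" for c t x
      by (rule norming_if_dense[OF dense that])
    have "card (torus_grid (2 ^ g) :: (real ^ 'd) set) \<le> 2 ^ (g * d)"
      using card_torus_grid_le[of "2 ^ g", where 'd='d] by (simp add: d_def power_mult)
    then have "real (4 * card (torus_grid (2 ^ g) :: (real ^ 'd) set) + 1) \<le> real (4 * 2 ^ (g * d) + 1)"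
      by (intro of_nat_mono) simp
    also have "\<dots> \<le> 4 * 2 ^ (g * d) + 4 * 2 ^ (g * d)"
    proof -
      have "1 \<le> (2::real) ^ (g * d)" "real (4 * 2 ^ (g * d) + 1) = 4 * 2 ^ (g * d) + 1" by simp_all
      then show ?thesis by linarith
    qed
    also have "\<dots> = 2 ^ (g * d + 3)" by (simp add: power_add)
    also have "\<dots> \<le> exp (real (g * d + 3))" by (rule two_power_le_exp)
    also have "\<dots> \<le> exp L" using L by simp
    finally show "real (4 * card (torus_grid (2 ^ g) :: (real ^ 'd) set) + 1) \<le> exp L" .
  qed
qed

section \<open>Choice of the parameters for the step hyperbolic cross\<close>

theorem theorem3p2:
  fixes q :: real
  assumes "1 \<le> q" and "q \<le> 2"
  shows "\<exists>C::real. \<forall>n::nat. n \<ge> 1 \<longrightarrow>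
    (\<exists>(m::nat) (\<xi> :: nat \<Rightarrow> real ^ 'd::finite).
      m > 0 \<and>
      real m \<le> C * real (card (step_hyperbolic_cross n :: (int ^ 'd) set)) * real n ^ 3 \<and>
      (\<forall>j\<in>{1..m}. \<xi> j \<in> torus) \<and>
      (\<forall>f \<in> trig_polys (step_hyperbolic_cross n :: (int ^ 'd) set).
        1 / 2 * torus_norm q f powr q \<le> 1 / real m * (\<Sum>j=1..m. cmod (f (\<xi> j)) powr q) \<and>
        1 / real m * (\<Sum>j=1..m. cmod (f (\<xi> j)) powr q) \<le> 3 / 2 * torus_norm q f powr q))"
proof -
  define d where "d = CARD('d)"
  \<comment> \<open>For \<open>n \<ge> 1\<close> this gives
    \<open>(n + 2) * d + 5 \<le> l * n\<close>, so \<open>2 ^ (l * n)\<close> is at least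
    \<open>32 * N\<close> and \<open>l * n\<close> can bound the number of layers.\<close>
  define l where "l = 3 * d + 5"
  \<comment> \<open>\<open>L * n\<close> has to dominate both \<open>g * d + 3\<close>, for the size
    of the grid, and \<open>l * n + 2\<close>, for the union over the layers.\<close>
  define L where "L = (4 * d + 5) * d + 3 + (l + 2)"
  define K :: real where "K = 3072 * (1026 * 2 ^ 18 + 1)"
  have d: "1 \<le> d" by (simp add: d_def Suc_le_eq)
  show ?thesis
  proof (intro exI[of _ "2 * K * real L * (real l)\<^sup>2"] allI impI)
    fix n :: nat
    assume n: "1 \<le> n"
    let ?Q = "step_hyperbolic_cross n :: (int ^ 'd) set"
    define N where "N = real (card ?Q)"
    define g where "g = (4 * d + 5) * n"
    have nd: "(n + 2) * d \<le> 3 * d * n" "d \<le> d * n" using n by (cases n; simp add: algebra_simps)+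
    have Ln: "L * n = g * d + 3 * n + (l * n + 2 * n)" by (simp add: L_def g_def algebra_simps)
    interpret sampled_orthonormal_system "torus_measure :: (real ^ 'd) measure" character ?Q torus q "torus_grid (2 ^ g)" "real (L * n)"
    proof (rule character_sampled[OF assms])
      show "(n + 2) * CARD('d) + n + CARD('d) + 4 \<le> g"
      proof -
        have "g = 3 * d * n + d * n + 5 * n" by (simp add: g_def algebra_simps)
        then show ?thesis using nd n unfolding d_def[symmetric] by linarith
      qed
      have "g * d + 3 \<le> L * n"
        using n Ln by linarith
      then show "real (g * CARD('d) + 3) \<le> real (L * n)" unfolding d_def by (rule of_nat_mono)
    qed
    have N: "1 \<le> N" "N \<le> 2 ^ ((n + 2) * d)"
      using real_card_step_hyperbolic_cross[where 'd='d, of n] unfolding N_def d_def .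
    \<comment> \<open>One factor \<open>n\<close> is the entropy cost per greedy step; the other two
      come from the sampling accuracy \<open>1 / (16 * l * n)\<close>.\<close>
    define R where "R = K * (N * real (L * n) * (real (l * n))\<^sup>2)"
    \<comment> \<open>As \<open>1 \<le> R\<close>, rounding up at most doubles it; this is the
      \<open>2\<close> in the final constant.\<close>
    define m where "m = nat \<lceil>R\<rceil>"
    have "0 < L * n" "0 < l * n" using n by (simp_all add: L_def l_def)
    then have "1 \<le> real (L * n)" "1 \<le> real (l * n)" by linarith+
    then have "1 * (1 * 1 * 1\<^sup>2) \<le> R"
      unfolding R_def using N by (intro mult_mono power_mono) (simp_all add: K_def)
    then have R: "1 \<le> R" by simp
    have m: "0 < m" "R \<le> real m" "real m \<le> 2 * R" using R unfolding m_def by linarith+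
    have "32 * N \<le> 2 ^ 5 * 2 ^ ((n + 2) * d)" using N by simp
    also have "\<dots> = 2 ^ ((n + 2) * d + 5)" by (simp only: power_add mult.commute)
    also have "\<dots> \<le> 2 ^ (l * n)"
    proof (intro power_increasing)
      have "l * n = 3 * d * n + 5 * n" by (simp add: l_def algebra_simps)
      then show "(n + 2) * d + 5 \<le> l * n" using nd n by linarith
    qed simp
    finally have l0: "32 * real (card ?Q) \<le> 2 ^ (l * n)" by (simp add: N_def)
    have "real (4 * (l * n)) \<le> real (4 * 2 ^ (l * n))" by (intro of_nat_mono) simp
    also have "\<dots> = 2 ^ (l * n + 2)" by (simp add: power_add)
    also have "\<dots> \<le> exp (real (l * n + 2))" by (rule two_power_le_exp)
    also have "\<dots> \<le> exp (real (L * n))"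
    proof -
      have "l * n + 2 \<le> L * n" using n Ln by linarith
      then show ?thesis by (metis exp_le_cancel_iff of_nat_le_iff)
    qed
    finally have l1: "real (4 * (l * n)) \<le> exp (real (L * n))" .
    obtain \<xi> where \<xi>: "\<forall>j\<in>{1..m}. \<xi> j \<in> torus"
      "\<And>c. (\<Sum>j=1..m. cmod (lincomb c (\<xi> j)) powr q) / m \<in> {1 / 2 * mass c..3 / 2 * mass c}"
      using exists_discretization[OF l0 l1 m(1)] m(2) unfolding R_def K_def N_def by blast
    have "1 / 2 * torus_norm q f powr q \<le> 1 / real m * (\<Sum>j=1..m. cmod (f (\<xi> j)) powr q) \<and>
        1 / real m * (\<Sum>j=1..m. cmod (f (\<xi> j)) powr q) \<le> 3 / 2 * torus_norm q f powr q"
      if f: "f \<in> trig_polys ?Q" for f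
    proof -
      obtain c where c: "f = lincomb c"
        using f by (auto simp: trig_polys_def lincomb_def character_def cis_conv_exp fun_eq_iff)
      have "torus_norm q f powr q = mass c"
        using assms mass_nonneg[of c] by (simp add: c torus_norm_def mass_def powr_powr)
      then show ?thesis using \<xi>(2)[of c] by (simp add: c)
    qed
    moreover have "real m \<le> 2 * K * real L * (real l)\<^sup>2 * N * real n ^ 3"
      using m(3) by (simp add: R_def power_mult_distrib power2_eq_square power3_eq_cube mult_ac)
    ultimately show "\<exists>m (\<xi> :: nat \<Rightarrow> real ^ 'd). m > 0 \<and>
      real m \<le> 2 * K * real L * (real l)\<^sup>2 * real (card ?Q) * real n ^ 3 \<and>
      (\<forall>j\<in>{1..m}. \<xi> j \<in> torus) \<and>
      (\<forall>f \<in> trig_polys ?Q.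
        1 / 2 * torus_norm q f powr q \<le> 1 / real m * (\<Sum>j=1..m. cmod (f (\<xi> j)) powr q) \<and>
        1 / real m * (\<Sum>j=1..m. cmod (f (\<xi> j)) powr q) \<le> 3 / 2 * torus_norm q f powr q)"
      using m(1) \<xi>(1) unfolding N_def by blast
  qed
qed

end
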